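(* Let $m\ge1$ be an integer and $B>1$. Define \[F_m(B)=\{x\in[0,1): a_{n+1}(x)\cdots a_{n+m}(x)\ge B^n\text{ for infinitely many } n\}.\] Then $F_m(B)\in\mathscr{G}^u([0,1])$ for some $u\in(1/2,1)$ satisfying \[P(-u\log|G'|-g_m(u)\log B,G)=0,\qquad\text{where } g_m(u)=\frac{u^m(2u-1)}{u^m-(1-u)^m}.\]
   Context: $G$ is the Gauss map, $G(0)=0$, $G(x)=1/x\pmod 1$ for $x\in(0,1)$. For irrational $x\in(0,1)$, its partial quotients are $a_1(x)=\lfloor1/x\rfloor$ and $a_n(x)=a_1(G^{n-1}x)$. The $n$th level cylinder is $I_n(a_1,\dots,a_n)=\{x: a_k(x)=a_k,1\le k\le n\}$. For a continuous $\phi$, $S_n\phi=\sum_{k=0}^{n-1}\phi\circ G^k$ and the pressure is $P(\phi,G)=\lim_{n\to\infty}\frac1n\log\sum_{(a_1,\dots,a_n)\in\mathbb{N}^n}e^{S_n\phi(y)}$ with $y\in I_n(a_1,\dots,a_n)$. Hausdorff content: $\mathcal{H}^t_\infty(A)=\inf\{\sum_i|B_i|^t: A\subset\bigcup_iB_i,\ B_i\text{ balls}\}$. For $0<s\le1$, $\mathscr{G}^s([0,1])$ is the class of $G_\delta$ subsets $A\subset[0,1]$ for which there is $c>0$ such that for every $0<t<s$ and every ball $B\subset[0,1]$, $\mathcal{H}^t_\infty(A\cap B)>c\,\mathcal{H}^t_\infty(B)$. *)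

theory Defs
  imports "HOL-Analysis.Analysis"
begin

definition gauss_map :: "real \<Rightarrow> real" where
  "gauss_map x = (if x = 0 then 0 else frac (1 / x))"

(* Indices start at 1, and only irrational x in (0,1) are meaningful arguments. *)
definition partial_quotient :: "nat \<Rightarrow> real \<Rightarrow> nat" where
  "partial_quotient n x = nat \<lfloor>1 / (gauss_map ^^ (n - 1)) x\<rfloor>"

definition cylinder :: "nat list \<Rightarrow> real set" where
  "cylinder as = {x \<in> {0<..<1} - \<rat>. \<forall>k\<in>{1..length as}. partial_quotient k x = as ! (k - 1)}"

definition birkhoff_sum :: "(real \<Rightarrow> real) \<Rightarrow> nat \<Rightarrow> real \<Rightarrow> real" where
  "birkhoff_sum \<phi> n x = (\<Sum>k<n. \<phi> ((gauss_map ^^ k) x))"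

definition ln_ennreal :: "ennreal \<Rightarrow> ereal" where
  "ln_ennreal z = (if z = 0 then - \<infinity> else if z = \<infinity> then \<infinity> else ereal (ln (enn2real z)))"

definition partition_sum :: "(real \<Rightarrow> real) \<Rightarrow> (nat list \<Rightarrow> real) \<Rightarrow> nat \<Rightarrow> ennreal" where
  "partition_sum \<phi> y n =
     (\<Sum>\<^sub>\<infinity>as\<in>{as. length as = n \<and> (\<forall>a\<in>set as. a \<ge> 1)}. ennreal (exp (birkhoff_sum \<phi> n (y as))))"

(* has_pressure \<phi> p says that P(\<phi>, G) exists and equals p.  The sample points y as in the
   cylinders are arbitrary, so the limit is required to exist and to be p for every choice of them;
   the cylinder of a list of positive integers is never empty, so such choices exist.  The sum and
   the limit are extended-valued, so a divergent partition sum contributes \<infinity>. *)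
definition has_pressure :: "(real \<Rightarrow> real) \<Rightarrow> ereal \<Rightarrow> bool" where
  "has_pressure \<phi> p \<longleftrightarrow>
     (\<forall>y. (\<forall>as. (\<forall>a\<in>set as. a \<ge> 1) \<longrightarrow> y as \<in> cylinder as) \<longrightarrow>
          (\<lambda>n. ln_ennreal (partition_sum \<phi> y n) / ereal (real n)) \<longlonglongrightarrow> p)"

(* Balls of nonpositive radius are empty, so for t > 0 the countable covers below include the
   finite ones. *)
definition hausdorff_content :: "real \<Rightarrow> real set \<Rightarrow> ennreal" where
  "hausdorff_content t A =
     Inf {(\<Sum>i. ennreal (diameter (U i) powr t)) | U :: nat \<Rightarrow> real set.
            (\<forall>i. \<exists>c r. U i = ball c r) \<and> A \<subseteq> (\<Union>i. U i)}"

definition large_intersection_class :: "real \<Rightarrow> real set set" where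
  "large_intersection_class s =
     {A. gdelta_in (top_of_set {0..1}) A \<and>
         (\<exists>c>0. \<forall>t. 0 < t \<and> t < s \<longrightarrow>
            (\<forall>x r. 0 < r \<and> ball x r \<subseteq> {0..1} \<longrightarrow>
               hausdorff_content t (A \<inter> ball x r) > ennreal c * hausdorff_content t (ball x r)))}"

(* Rational points have only finitely many partial quotients and are excluded. *)
definition F_set :: "nat \<Rightarrow> real \<Rightarrow> real set" where
  "F_set m B = {x \<in> {0..<1} - \<rat>.
     \<exists>\<^sub>\<infinity>n. real (\<Prod>i=1..m. partial_quotient (n + i) x) \<ge> B ^ n}"

definition g_exponent :: "nat \<Rightarrow> real \<Rightarrow> real" where
  "g_exponent m u = u ^ m * (2 * u - 1) / (u ^ m - (1 - u) ^ m)"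

end

theory Submission
  imports Defs
begin

text \<open>
  Let \<open>P t\<close> be the pressure of \<open>- t log |G'|\<close>, let \<open>g\<close> be \<open>g_exponent m\<close>, and let \<open>u\<close> be the smallest
  zero of \<open>P t - g t log B\<close> in \<open>(1/2, 1)\<close>; then \<open>P t > g t log B\<close> for \<open>1/2 < t < u\<close>.
  For such \<open>t\<close> every cylinder \<open>I\<close> of any level \<open>N\<close> carries a probability density living on the points
  with \<open>a\<^bsub>n+1\<^esub> \<dots> a\<^bsub>n+m\<^esub> \<ge> B ^ n\<close> for some \<open>n \<ge> N\<close> that gives an interval \<open>J\<close> mass at most
  \<open>K (|J| / |I|) powr t\<close>, with \<open>K\<close> independent of \<open>I\<close>: after the digits of \<open>I\<close>, take independent blocks
  \<open>w\<close> of a fixed length, with weights proportional to \<open>q(w) powr (- 2 * t)\<close>, and then \<open>m\<close> large digits whose sizes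
  are in the proportions that make the constraints at all intermediate scales coincide. Each block
  gains a factor \<open>< B powr (- g t * length w)\<close>, and the large digits cost \<open>B powr (n * g t)\<close>, so that many blocks
  absorb every constant.

  Since \<open>t < 1\<close>, replacing a bounded density on tiny cylinders by these ones changes its Frostman
  constant by as little as we like. Starting from the uniform density on a ball and iterating gives
  nested compact sets whose intersection lies in \<open>F_set m B\<close>, and finite subcovers then bound its
  Hausdorff content from below, with a constant that does not depend on \<open>t\<close>.
\<close>

section \<open>Continued fraction cylinders\<close>

text \<open>The exponent comes from a balance. If a digit is drawn uniformly from
  \<open>[A, 2 * A)\<close>, unit mass sits on an interval of relative length about
  \<open>1 / A\<close>, and mass \<open>1 / A\<close> on each child of relative length about
  \<open>1 / A^2\<close>. A Frostman constant \<open>h\<close> for the later digits thus becomes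
  about the larger of \<open>A powr t\<close> and \<open>A powr (2 * t - 1) * h\<close>. If the two
  agree at every stage and the first digit has size \<open>x\<close>, the total constant is about
  \<open>x powr t\<close>, while the product of the digits is \<open>x powr S\<close> with
  \<open>S = 1 + r + ... + r^(m-1)\<close> and \<open>r = (1 - t) / t\<close>. Reaching
  \<open>B ^ n\<close> therefore costs \<open>B powr (n * t / S)\<close>, and \<open>t / S\<close>
  is exactly \<open>g_exponent m t\<close>. The obstacle is uniformity: nothing controls
  \<open>K\<close> as \<open>t\<close> approaches \<open>u\<close>, yet the class asks for one
  \<open>c\<close> for all \<open>t\<close>. So \<open>K\<close> may enter only through the choice
  of how small the cylinders are; over all stages the Frostman constant at most doubles and at least
  half of the mass survives.\<close>

definition pos_word :: "nat list \<Rightarrow> bool" where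
  "pos_word w \<longleftrightarrow> (\<forall>a\<in>set w. a \<ge> 1)"

lemma pos_word_simps [simp]:
  "pos_word []" "pos_word (a # w) \<longleftrightarrow> a \<ge> 1 \<and> pos_word w"
  "pos_word (u @ v) \<longleftrightarrow> pos_word u \<and> pos_word v"
  by (auto simp: pos_word_def)

text \<open>The inverse branch, with digits \<open>w\<close>, of the \<open>length w\<close>-th
  iterate of the Gauss map. The tail \<open>z\<close> may also be 0 or 1, which gives the endpoints
  of the cylinder.\<close>

fun cf :: "nat list \<Rightarrow> real \<Rightarrow> real" where
  "cf [] z = z"
| "cf (a # w) z = 1 / (real a + cf w z)"

text \<open>If \<open>x = cf w z\<close> with \<open>0 < z < 1\<close>, then \<open>den w z\<close> is \<open>q\<^sub>n + z q\<^bsub>n-1\<^esub>\<close>, the reciprocal of the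
  product of the first \<open>n = length w\<close> points of the Gauss orbit of \<open>x\<close>.\<close>

fun den :: "nat list \<Rightarrow> real \<Rightarrow> real" where
  "den [] z = 1"
| "den (a # w) z = (real a + cf w z) * den w z"

text \<open>The length of the interval \<open>cyl w\<close>, read off from \<open>cf_diff\<close> at
  the tails 1 and 0.\<close>

definition len :: "nat list \<Rightarrow> real" where
  "len w = 1 / (den w 0 * den w 1)"

text \<open>In contrast to \<open>cylinder\<close>, rational points stay in, which makes this an
  open interval.\<close>

definition cyl :: "nat list \<Rightarrow> real set" where
  "cyl w = cf w ` {0<..<1}"

lemma cf_nonneg: "z \<ge> 0 \<Longrightarrow> cf w z \<ge> 0"
  by (induction w) auto

lemma cf_le_1: "pos_word w \<Longrightarrow> 0 \<le> z \<Longrightarrow> z \<le> 1 \<Longrightarrow> cf w z \<le> 1"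
proof (induction w)
  case (Cons a w)
  have "real a + cf w z \<ge> 1"
    using Cons.prems cf_nonneg[of z w] by simp
  then show ?case by simp
qed simp

lemma cf_01: "pos_word w \<Longrightarrow> 0 < z \<Longrightarrow> z < 1 \<Longrightarrow> 0 < cf w z \<and> cf w z < 1"
proof (induction w)
  case (Cons a w)
  have "real a + cf w z > 1"
    using Cons by simp
  then show ?case by simp
qed simp

lemma den_ge_1: "pos_word w \<Longrightarrow> z \<ge> 0 \<Longrightarrow> den w z \<ge> 1"
proof (induction w)
  case (Cons a w)
  have "real a + cf w z \<ge> 1"
    using Cons.prems cf_nonneg[of z w] by simp
  then show ?case using Cons mult_mono[of 1 "real a + cf w z" 1 "den w z"] by simp
qed simp

lemma den_pos: "pos_word w \<Longrightarrow> z \<ge> 0 \<Longrightarrow> den w z > 0"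
  using den_ge_1[of w z] by linarith

lemma cf_append: "cf (u @ v) z = cf u (cf v z)"
  by (induction u) auto

lemma den_append: "den (u @ v) z = den u (cf v z) * den v z"
  by (induction u) (auto simp: cf_append)

text \<open>\<open>cf w\<close> is a Moebius map with denominator \<open>den w\<close> and
  determinant \<open>(-1) ^ length w\<close>.\<close>

lemma cf_diff:
  assumes "pos_word w" "0 \<le> z" "0 \<le> z'"
  shows "cf w z - cf w z' = (-1) ^ length w * (z - z') / (den w z * den w z')"
  using assms(1)
proof (induction w)
  case (Cons a w)
  have p: "real a + cf w z > 0" "real a + cf w z' > 0"
    using Cons.prems cf_nonneg[of z w] cf_nonneg[of z' w] assms by simp_all
  have d: "den w z > 0" "den w z' > 0"
    using Cons.prems den_pos assms by auto
  have "cf (a # w) z - cf (a # w) z' =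
      - (cf w z - cf w z') / ((real a + cf w z) * (real a + cf w z'))"
    using p by (simp add: divide_simps)
  also have "cf w z - cf w z' = (-1) ^ length w * (z - z') / (den w z * den w z')"
    using Cons by simp
  also have "- \<dots> / ((real a + cf w z) * (real a + cf w z')) =
      (-1) ^ length (a # w) * (z - z') / (den (a # w) z * den (a # w) z')"
    by (simp add: mult_ac)
  finally show ?case .
qed simp

text \<open>The condition on \<open>p' + q'\<close> is what carries \<open>q' \<le> q\<close> through the induction.\<close>

lemma den_affine_aux:
  assumes "pos_word w"
  shows "\<exists>p p' q q'. 0 \<le> p \<and> 0 \<le> p' \<and> 0 \<le> q \<and> 0 \<le> q' \<and> q' \<le> q \<and> p' + q' \<le> p + q \<and>
    (\<forall>z\<ge>0. den w z = q + q' * z \<and> den w z * cf w z = p + p' * z)"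
  using assms
proof (induction w)
  case Nil
  show ?case
    by (rule exI[of _ 0], rule exI[of _ 1], rule exI[of _ 1], rule exI[of _ 0]) auto
next
  case (Cons a w)
  then have "pos_word w" by simp
  from Cons.IH[OF this] obtain p p' q q' where h: "0 \<le> p" "0 \<le> p'" "0 \<le> q" "0 \<le> q'" "q' \<le> q"
    "p' + q' \<le> p + q" and h': "\<forall>z\<ge>0. den w z = q + q' * z \<and> den w z * cf w z = p + p' * z"
    by (elim exE conjE)
  note h = h h'[rule_format, THEN conjunct1] h'[rule_format, THEN conjunct2]
  have a: "real a \<ge> 1" using Cons.prems by simp
  have d1: "den (a # w) z = (real a * q + p) + (real a * q' + p') * z" if "z \<ge> 0" for z
  proof -
    have "den (a # w) z = real a * den w z + den w z * cf w z" by (simp add: algebra_simps)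
    also have "\<dots> = real a * (q + q' * z) + (p + p' * z)"
      using h(7,8)[OF that] by (simp only:)
    finally show ?thesis by (simp add: algebra_simps)
  qed
  have d2: "den (a # w) z * cf (a # w) z = q + q' * z" if "z \<ge> 0" for z
  proof -
    have "real a + cf w z > 0" using a cf_nonneg[OF that, of w] by linarith
    then show ?thesis using h(7)[OF that] by simp
  qed
  have m: "(real a - 1) * q' \<le> (real a - 1) * q"
    using a h by (intro mult_left_mono) auto
  then have m': "real a * q' + p' \<le> real a * q + p"
    using h(6) by (simp add: algebra_simps)
  have pos: "0 \<le> real a * q + p" "0 \<le> real a * q' + p'" using h(1-4) a by auto
  have s: "q' + (real a * q' + p') \<le> q + (real a * q + p)" using m' h(5) by linarith
  show ?case
    by (intro exI[of _ q] exI[of _ q'] exI[of _ "real a * q + p"] exI[of _ "real a * q' + p'"] conjI allI impI)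
       (fact h(3,4) pos m' s d1 d2)+
qed

lemma den_affine:
  assumes "pos_word w"
  obtains q q' where "0 \<le> q'" "q' \<le> q" "\<And>z. z \<ge> 0 \<Longrightarrow> den w z = q + q' * z"
proof -
  from den_affine_aux[OF assms] obtain p p' q q' where "0 \<le> q'" "q' \<le> q"
    "\<forall>z\<ge>0. den w z = q + q' * z \<and> den w z * cf w z = p + p' * z"
    by (elim exE conjE)
  then show ?thesis by (intro that[of q' q]) auto
qed

lemma den_mono: 
  assumes "pos_word w" "0 \<le> z" "z \<le> z'"
  shows "den w z \<le> den w z'"
proof -
  obtain q q' where h: "0 \<le> q'" "q' \<le> q" "\<And>z. z \<ge> 0 \<Longrightarrow> den w z = q + q' * z"
    by (rule den_affine[OF assms(1)]) (rule that)
  show ?thesis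
    unfolding h(3)[OF assms(2)] h(3)[OF order.trans[OF assms(2,3)]]
    by (intro add_left_mono mult_left_mono assms(3) h(1))
qed

text \<open>The slope of the affine function \<open>den w\<close> is at most its value at 0. This
  factor 2 is bounded distortion; the constants 2, 4 and 8 in the later comparisons of cylinders
  come from it.\<close>

lemma den_distortion: 
  assumes "pos_word w" "0 \<le> z" "z \<le> 1" 
  shows "den w z \<le> 2 * den w 0"
proof -
  obtain q q' where h: "0 \<le> q'" "q' \<le> q" "\<And>z. z \<ge> 0 \<Longrightarrow> den w z = q + q' * z"
    by (rule den_affine[OF assms(1)]) (rule that)
  have "q' * z \<le> q' * 1" by (intro mult_left_mono assms(3) h(1))
  moreover have "den w 0 = q" by (simp only: h(3)[OF order.refl] mult_zero_right add_0_right)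
  moreover note h(3)[OF assms(2)]
  ultimately show ?thesis using h(2) by linarith
qed

lemma den_append_bounds:
  assumes "pos_word u" "pos_word v"
  shows "den u 0 * den v 0 \<le> den (u @ v) 0" "den (u @ v) 0 \<le> 2 * den u 0 * den v 0"
proof -
  have c: "0 \<le> cf v 0" "cf v 0 \<le> 1" using cf_nonneg cf_le_1 assms by auto
  have d: "0 \<le> den v 0" using den_pos[OF assms(2), of 0] by simp
  show "den u 0 * den v 0 \<le> den (u @ v) 0"
    unfolding den_append using den_mono[OF assms(1) _ c(1)] d by (intro mult_right_mono) auto
  show "den (u @ v) 0 \<le> 2 * den u 0 * den v 0"
    unfolding den_append using den_distortion[OF assms(1) c] d by (intro mult_right_mono) auto
qed

text \<open>A single digit 1 may leave \<open>den\<close> almost unchanged, but two digits together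
  multiply it by \<open>a * (b + y) + 1\<close>, which is at least 2. Hence the induction in steps
  of two.\<close>

lemma den_growth: "pos_word w \<Longrightarrow> z \<ge> 0 \<Longrightarrow> den w z \<ge> 2 ^ (length w div 2)"
proof (induction w rule: induct_list012)
  case (2 x)
  then show ?case by simp
next
  case (3 a b w)
  define y where "y = cf w z"
  have y: "y \<ge> 0" using cf_nonneg 3 by (simp add: y_def)
  have ab: "real a \<ge> 1" "real b \<ge> 1" using 3 by auto
  have "den (a # b # w) z = (real a * (real b + y) + 1) * den w z"
    using y ab by (simp add: y_def[symmetric] field_simps)
  moreover have "real a * (real b + y) \<ge> 1 * 1"
    using ab y by (intro mult_mono) auto
  moreover have "den w z \<ge> 2 ^ (length w div 2)" using 3 by simp
  moreover have "2 * 2 ^ (length w div 2) \<le> (real a * (real b + y) + 1) * den w z"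
    using calculation(2,3) by (intro mult_mono) auto
  ultimately have "den (a # b # w) z \<ge> 2 * 2 ^ (length w div 2)" by linarith
  then show ?case by simp
qed simp

section \<open>Lengths of cylinders, and cylinders as intervals\<close>

lemma len_pos: "pos_word w \<Longrightarrow> len w > 0"
  by (simp add: len_def den_pos)

lemma len_bounds:
  assumes "pos_word w"
  shows "1 / (2 * (den w 0)\<^sup>2) \<le> len w" "len w \<le> 1 / (den w 0)\<^sup>2"
proof -
  have d: "den w 0 > 0" "den w 1 > 0" using den_pos assms by auto
  have "den w 0 * den w 1 \<le> den w 0 * (2 * den w 0)"
    using den_distortion[OF assms, of 1] d by (intro mult_left_mono) auto
  then show "1 / (2 * (den w 0)\<^sup>2) \<le> len w"
    unfolding len_def using d by (intro divide_left_mono) (auto simp: power2_eq_square)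
  have "den w 0 * den w 0 \<le> den w 0 * den w 1"
    using den_mono[OF assms, of 0 1] d by (intro mult_left_mono) auto
  then show "len w \<le> 1 / (den w 0)\<^sup>2"
    unfolding len_def power2_eq_square using d by (intro divide_left_mono) auto
qed

text \<open>The 8 is \<open>2 * 2^2\<close>: a factor 2 from \<open>len_bounds\<close> for
  \<open>u @ v\<close>, and the squared factor 2 from \<open>den_append_bounds\<close>.\<close>

lemma len_append:
  assumes "pos_word u" "pos_word v"
  shows "len u / (8 * (den v 0)\<^sup>2) \<le> len (u @ v)"
proof -
  have d: "den u 0 > 0" "den v 0 > 0" "den (u @ v) 0 > 0" using den_pos assms by auto
  have "len u / (8 * (den v 0)\<^sup>2) \<le> (1 / (den u 0)\<^sup>2) / (8 * (den v 0)\<^sup>2)"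
    using len_bounds[OF assms(1)] by (intro divide_right_mono) auto
  also have "\<dots> = 1 / (2 * (2 * den u 0 * den v 0)\<^sup>2)"
    by (simp add: power_mult_distrib)
  also have "\<dots> \<le> 1 / (2 * (den (u @ v) 0)\<^sup>2)"
    using den_append_bounds[OF assms] d 
    by (intro divide_left_mono mult_left_mono power_mono) auto
  also have "\<dots> \<le> len (u @ v)" using len_bounds[of "u @ v"] assms by simp
  finally show ?thesis .
qed

lemma len_le_growth: 
  assumes "pos_word w" shows "len w \<le> (1/4) ^ (length w div 2)"
proof -
  have "len w \<le> 1 / (den w 0)\<^sup>2" using len_bounds[OF assms] by simp
  also have "\<dots> \<le> 1 / (2 ^ (length w div 2))\<^sup>2"
    using den_growth[OF assms, of 0] den_pos[OF assms, of 0]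
    by (intro divide_left_mono power_mono) auto
  also have "\<dots> = (1/4) ^ (length w div 2)"
    by (simp add: power_one_over power_mult[symmetric] mult.commute power2_eq_square power_mult_distrib[symmetric])
  finally show ?thesis .
qed

text \<open>Each digit reverses the orientation, so the endpoint belonging to the tail 0 alternates
  between left and right; the disjunction saves tracking the parity of
  \<open>length w\<close>.\<close>

lemma cyl_eq_interval_aux:
  assumes "pos_word w"
  shows "\<exists>l h. 0 \<le> l \<and> l < h \<and> cyl w = {l<..<h} \<and>
    ((l = cf w 0 \<and> h = cf w 1) \<or> (l = cf w 1 \<and> h = cf w 0))"
  using assms
proof (induction w)
  case Nil
  show ?case by (auto simp: cyl_def)
next
  case (Cons a w)
  then obtain l h where lh: "0 \<le> l" "l < h" "cyl w = {l<..<h}"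
    "(l = cf w 0 \<and> h = cf w 1) \<or> (l = cf w 1 \<and> h = cf w 0)"
    by auto
  have a: "real a \<ge> 1" using Cons.prems by simp
  have "cyl (a # w) = (\<lambda>y. 1 / (real a + y)) ` cyl w"
    by (auto simp: cyl_def image_image)
  also have "\<dots> = {1 / (real a + h)<..<1 / (real a + l)}"
  proof (intro equalityI subsetI)
    fix x assume "x \<in> (\<lambda>y. 1 / (real a + y)) ` cyl w"
    then obtain y where y: "x = 1 / (real a + y)" "l < y" "y < h" using lh by auto
    then show "x \<in> {1 / (real a + h)<..<1 / (real a + l)}"
      using lh(1) a by (auto intro!: divide_strict_left_mono)
  next
    fix x assume x: "x \<in> {1 / (real a + h)<..<1 / (real a + l)}"
    have p: "real a + h > 0" "real a + l > 0" using lh a by auto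
    have "x > 1 / (real a + h)" using x by simp
    moreover have "1 / (real a + h) > 0" using p by simp
    ultimately have x0: "x > 0" by linarith
    have "1 / x < real a + h" "1 / x > real a + l"
      using x x0 p by (auto simp: field_simps)
    then have "1 / x - real a \<in> cyl w" unfolding lh(3) by auto
    moreover have "x = 1 / (real a + (1 / x - real a))" using x0 by simp
    ultimately show "x \<in> (\<lambda>y. 1 / (real a + y)) ` cyl w" by blast
  qed
  finally have e: "cyl (a # w) = {1 / (real a + h)<..<1 / (real a + l)}" .
  show ?case
    by (rule exI[of _ "1 / (real a + h)"], rule exI[of _ "1 / (real a + l)"])
       (use lh a e in \<open>auto intro!: divide_strict_left_mono\<close>)
qed

lemma cyl_eq_interval:
  assumes "pos_word w"
  obtains l h where "0 \<le> l" "l < h" "h \<le> 1" "cyl w = {l<..<h}" "h - l = len w"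
proof -
  obtain l h where lh: "0 \<le> l" "l < h" "cyl w = {l<..<h}"
    "(l = cf w 0 \<and> h = cf w 1) \<or> (l = cf w 1 \<and> h = cf w 0)"
    using cyl_eq_interval_aux[OF assms] by blast
  have h1: "h \<le> 1" using lh(4) cf_le_1[OF assms] by auto
  have "\<bar>cf w 1 - cf w 0\<bar> = len w"
    unfolding cf_diff[OF assms zero_le_one order.refl] len_def
    using den_pos[OF assms, of 0] den_pos[OF assms, of 1]
    by (simp add: abs_mult power_abs mult.commute)
  then have "h - l = len w" using lh(2,4) by auto
  then show ?thesis using that lh h1 by blast
qed

lemma open_cyl: "pos_word w \<Longrightarrow> open (cyl w)"
  by (rule cyl_eq_interval[of w]) auto

lemma cyl_append_subset:
  assumes "pos_word v" shows "cyl (u @ v) \<subseteq> cyl u"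
  unfolding cyl_def cf_append using cf_01[OF assms] by auto

lemma cyl_subset_01:
  assumes "pos_word w" shows "cyl w \<subseteq> {0<..<1}"
  unfolding cyl_def using cf_01[OF assms] by auto

section \<open>The Gauss orbit and its digits\<close>

lemma gauss_map_cf_Cons:
  assumes "0 < y" "y < 1" "a \<ge> 1"
  shows "gauss_map (1 / (real a + y)) = y" "nat \<lfloor>real a + y\<rfloor> = a"
proof -
  have "\<lfloor>real a + y\<rfloor> = int a" using assms by (simp add: floor_eq_iff)
  then show "nat \<lfloor>real a + y\<rfloor> = a" "gauss_map (1 / (real a + y)) = y" 
    using assms by (auto simp: gauss_map_def frac_def)
qed

lemma gauss_funpow_cf:
  assumes "pos_word w" "0 < z" "z < 1" "k \<le> length w"
  shows "(gauss_map ^^ k) (cf w z) = cf (drop k w) z"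
  using assms(4)
proof (induction k)
  case (Suc k)
  then have k: "k < length w" by simp
  have e: "drop k w = w ! k # drop (Suc k) w" using k by (simp add: Cons_nth_drop_Suc)
  have p: "pos_word (drop (Suc k) w)" "w ! k \<ge> 1"
    using assms(1) k by (auto simp: pos_word_def dest: in_set_dropD)
  have "(gauss_map ^^ Suc k) (cf w z) = gauss_map (cf (drop k w) z)"
    using Suc by simp
  also have "\<dots> = cf (drop (Suc k) w) z"
    unfolding e using gauss_map_cf_Cons(1)[of "cf (drop (Suc k) w) z" "w ! k"]
      cf_01[OF p(1) assms(2,3)] p by simp
  finally show ?case .
qed simp

lemma partial_quotient_cf:
  assumes "pos_word w" "0 < z" "z < 1" "k < length w"
  shows "partial_quotient (Suc k) (cf w z) = w ! k"
proof -
  have e: "drop k w = w ! k # drop (Suc k) w" using assms by (simp add: Cons_nth_drop_Suc)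
  have p: "pos_word (drop (Suc k) w)" "w ! k \<ge> 1"
    using assms(1,4) by (auto simp: pos_word_def dest: in_set_dropD)
  have "(gauss_map ^^ k) (cf w z) = 1 / (real (w ! k) + cf (drop (Suc k) w) z)"
    using gauss_funpow_cf[OF assms(1-3), of k] assms(4) e by simp
  then show ?thesis unfolding partial_quotient_def
    using gauss_map_cf_Cons(2)[of "cf (drop (Suc k) w) z" "w ! k"]
      cf_01[OF p(1) assms(2,3)] p by simp
qed

text \<open>The tail lies strictly between 0 and 1, so the first \<open>length w\<close> partial
  quotients can be read off at every point of \<open>cyl w\<close>, rational or not.\<close>

lemma cyl_disjoint:
  assumes "pos_word v" "pos_word w" "length v = length w" "x \<in> cyl v" "x \<in> cyl w"
  shows "v = w"
proof (rule nth_equalityI)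
  obtain z where z: "x = cf v z" "0 < z" "z < 1" using assms(4) by (auto simp: cyl_def)
  obtain z' where z': "x = cf w z'" "0 < z'" "z' < 1" using assms(5) by (auto simp: cyl_def)
  fix i assume "i < length v"
  then show "v ! i = w ! i"
    using partial_quotient_cf[OF assms(1) z(2,3)] partial_quotient_cf[OF assms(2) z'(2,3)] assms(3)
      z(1) z'(1) by simp
qed fact

definition digits :: "nat \<Rightarrow> real \<Rightarrow> nat list" where
  "digits n x = map (\<lambda>k. partial_quotient (Suc k) x) [0..<n]"

lemma gauss_irrational:
  assumes "x \<in> {0<..<1} - \<rat>"
  shows "gauss_map x \<in> {0<..<1} - \<rat>" "nat \<lfloor>1 / x\<rfloor> \<ge> 1" "1 / (real (nat \<lfloor>1 / x\<rfloor>) + gauss_map x) = x"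
proof -
  have x: "0 < x" "x < 1" "x \<notin> \<rat>" using assms by auto
  have x1: "1 / x > 1" using x by simp
  have i: "1 / x \<notin> \<rat>"
  proof
    assume "1 / x \<in> \<rat>"
    then have "inverse (1 / x) \<in> \<rat>" by (rule Rats_inverse)
    then show False using x by simp
  qed
  have fl: "\<lfloor>1 / x\<rfloor> \<ge> 1" using x1 by linarith
  show "nat \<lfloor>1 / x\<rfloor> \<ge> 1" using fl by linarith
  have e: "gauss_map x = 1 / x - of_int \<lfloor>1 / x\<rfloor>" using x by (simp add: gauss_map_def frac_def)
  have "gauss_map x \<notin> \<rat>"
  proof
    assume "gauss_map x \<in> \<rat>"
    then have "gauss_map x + of_int \<lfloor>1 / x\<rfloor> \<in> \<rat>" by (intro Rats_add) auto
    then show False using i e by simp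
  qed
  moreover from this have "gauss_map x \<noteq> 0" by auto
  moreover have "0 \<le> gauss_map x" "gauss_map x < 1" using x by (auto simp: gauss_map_def frac_lt_1)
  ultimately show "gauss_map x \<in> {0<..<1} - \<rat>" by auto
  show "1 / (real (nat \<lfloor>1 / x\<rfloor>) + gauss_map x) = x"
    using e fl x by (simp add: of_nat_nat)
qed

lemma gauss_funpow_irrational:
  assumes "x \<in> {0<..<1} - \<rat>"
  shows "(gauss_map ^^ n) x \<in> {0<..<1} - \<rat>"
  by (induction n) (use assms gauss_irrational(1) in auto)

lemma digits_props:
  assumes "x \<in> {0<..<1} - \<rat>"
  shows "length (digits n x) = n" "pos_word (digits n x)"
    "cf (digits n x) ((gauss_map ^^ n) x) = x"
proof -
  show "length (digits n x) = n" by (simp add: digits_def)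
  show "pos_word (digits n x)"
    using gauss_irrational(2)[OF gauss_funpow_irrational[OF assms]]
    by (auto simp: digits_def pos_word_def partial_quotient_def)
  show "cf (digits n x) ((gauss_map ^^ n) x) = x"
  proof (induction n)
    case (Suc n)
    have "digits (Suc n) x = digits n x @ [nat \<lfloor>1 / (gauss_map ^^ n) x\<rfloor>]"
      by (simp add: digits_def partial_quotient_def)
    then show ?case using gauss_irrational(3)[OF gauss_funpow_irrational[OF assms, of n]] Suc
      by (simp add: cf_append)
  qed (simp add: digits_def)
qed

lemma in_cyl_digits: 
  assumes "x \<in> {0<..<1} - \<rat>" shows "x \<in> cyl (digits n x)"
  using digits_props(3)[OF assms, of n] gauss_funpow_irrational[OF assms, of n]
  unfolding cyl_def by (intro image_eqI[of _ _ "(gauss_map ^^ n) x"]) auto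

lemma digits_append: "digits (n + k) x = digits n x @ map (\<lambda>i. partial_quotient (Suc i) x) [n..<n + k]"
  by (simp only: digits_def map_append[symmetric] upt_add_eq_append[of 0 n k, OF le0, symmetric])

section \<open>Densities and their masses\<close>

definition mass :: "(real \<Rightarrow> real) \<Rightarrow> real set \<Rightarrow> real" where
  "mass g S = (LINT x|lborel. g x * indicator S x)"

text \<open>Bounded densities replace measures: countable sets then carry no mass, and an interval
  of length \<open>l\<close> carries at most \<open>M * l\<close>. No uniformity of \<open>M\<close>
  along the construction is needed.\<close>

definition bdens :: "real \<Rightarrow> (real \<Rightarrow> real) \<Rightarrow> bool" where
  "bdens M g \<longleftrightarrow> g \<in> borel_measurable borel \<and> (\<forall>x. 0 \<le> g x \<and> g x \<le> M * indicator {0..1} x)"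

lemma bdensD:
  assumes "bdens M g"
  shows "g \<in> borel_measurable borel" "0 \<le> g x" "g x \<le> M" "M \<ge> 0"
proof -
  have h: "0 \<le> g x" "g x \<le> M * indicator {0..1} x" for x using assms by (auto simp: bdens_def)
  show m: "M \<ge> 0" using h[of 0] by simp
  show "g \<in> borel_measurable borel" "0 \<le> g x" using assms by (auto simp: bdens_def)
  show "g x \<le> M" using h(2)[of x] m by (cases "x \<in> {0..1}") simp_all
qed

lemma bdens_integrable:
  assumes "bdens M g" "S \<in> sets borel"
  shows "integrable lborel (\<lambda>x. g x * indicator S x)"
proof (rule Bochner_Integration.integrable_bound)
  show "integrable lborel (\<lambda>x. M * indicator {0..1::real} x)" by simp
  show "(\<lambda>x. g x * indicator S x) \<in> borel_measurable lborel"
    using bdensD(1)[OF assms(1)] assms(2) by simp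
  have h: "0 \<le> g x" "g x \<le> M * indicator {0..1} x" for x using assms(1) by (auto simp: bdens_def)
  show "AE x in lborel. norm (g x * indicator S x) \<le> norm (M * indicator {0..1} x)"
  proof (rule AE_I2)
    fix x
    have "norm (g x * indicator S x) \<le> g x" using h(1)[of x] by (auto simp: indicator_def)
    also have "\<dots> \<le> M * indicator {0..1} x" by (rule h(2))
    also have "\<dots> \<le> norm (M * indicator {0..1} x)" unfolding real_norm_def by (rule abs_ge_self)
    finally show "norm (g x * indicator S x) \<le> norm (M * indicator {0..1} x)" .
  qed
qed

lemma mass_nonneg: "bdens M g \<Longrightarrow> mass g S \<ge> 0"
  unfolding mass_def by (rule Bochner_Integration.integral_nonneg) (simp add: bdensD(2))

lemma mass_cong_supp:
  assumes "\<And>x. g x \<noteq> 0 \<Longrightarrow> x \<in> S \<longleftrightarrow> x \<in> T"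
  shows "mass g S = mass g T"
  unfolding mass_def by (rule Bochner_Integration.integral_cong) (use assms in \<open>auto simp: indicator_def\<close>)

lemma mass_mono:
  assumes "bdens M g" "S \<in> sets borel" "T \<in> sets borel" "S \<subseteq> T"
  shows "mass g S \<le> mass g T"
  unfolding mass_def using bdensD(2)[OF assms(1)]
  by (intro Bochner_Integration.integral_mono bdens_integrable[OF assms(1)] assms)
     (use assms(4) in \<open>auto simp: indicator_def\<close>)

lemma mass_le_Lebesgue:
  assumes "bdens M g" "a \<le> b"
  shows "mass g {a..b} \<le> M * (b - a)"
proof -
  have "mass g {a..b} \<le> (LINT x|lborel. M * indicator {a..b} x)"
    unfolding mass_def
  proof (rule Bochner_Integration.integral_mono)
    show "integrable lborel (\<lambda>x. g x * indicator {a..b} x)" by (rule bdens_integrable[OF assms(1)]) simp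
    show "integrable lborel (\<lambda>x. M * indicator {a..b} x)"
      by (intro integrable_mult_right integrable_real_indicator) (auto simp: emeasure_lborel_Icc_eq)
    show "g x * indicator {a..b} x \<le> M * indicator {a..b} x" for x
      using bdensD(3)[OF assms(1)] by (intro mult_right_mono) auto
  qed
  also have "\<dots> = M * (b - a)" using assms by simp
  finally show ?thesis .
qed

lemma mass_restrict: "mass (\<lambda>x. g x * indicator V x) S = mass g (V \<inter> S)"
  unfolding mass_def by (simp add: indicator_inter_arith mult.assoc)

lemma bdens_restrict: 
  assumes "bdens M g" "V \<in> sets borel" shows "bdens M (\<lambda>x. g x * indicator V x)"
proof -
  have "(\<lambda>x. g x * indicator V x) \<in> borel_measurable borel"
    using bdensD(1)[OF assms(1)] assms(2) by simp
  moreover have "0 \<le> g x * indicator V x \<and> g x * indicator V x \<le> M * indicator {0..1} x" for x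
  proof (cases "x \<in> V")
    case True
    then show ?thesis using assms(1) unfolding bdens_def by simp
  next
    case False
    then show ?thesis using bdensD(4)[OF assms(1)] by simp
  qed
  ultimately show ?thesis unfolding bdens_def by blast
qed

lemma bdens_sum:
  assumes "finite W" "\<And>w. w \<in> W \<Longrightarrow> bdens (M w) (g w)" "\<And>w. w \<in> W \<Longrightarrow> c w \<ge> 0"
  shows "bdens (\<Sum>w\<in>W. c w * M w) (\<lambda>x. \<Sum>w\<in>W. c w * g w x)"
proof -
  have "(\<lambda>x. \<Sum>w\<in>W. c w * g w x) \<in> borel_measurable borel"
    using bdensD(1)[OF assms(2)] by (intro borel_measurable_sum borel_measurable_times) auto
  moreover have "0 \<le> (\<Sum>w\<in>W. c w * g w x)" for x
    using bdensD(2)[OF assms(2)] assms(3) by (intro sum_nonneg) auto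
  moreover have "(\<Sum>w\<in>W. c w * g w x) \<le> (\<Sum>w\<in>W. c w * M w) * indicator {0..1} x" for x
  proof -
    have "(\<Sum>w\<in>W. c w * g w x) \<le> (\<Sum>w\<in>W. c w * (M w * indicator {0..1} x))"
      using assms(2,3) by (intro sum_mono mult_left_mono) (auto simp: bdens_def)
    then show ?thesis by (simp add: sum_distrib_right mult.assoc)
  qed
  ultimately show ?thesis unfolding bdens_def by blast
qed

lemma mass_sum:
  assumes "\<And>w. w \<in> W \<Longrightarrow> bdens (M w) (g w)" "S \<in> sets borel"
  shows "mass (\<lambda>x. \<Sum>w\<in>W. c w * g w x) S = (\<Sum>w\<in>W. c w * mass (g w) S)"
proof -
  have "mass (\<lambda>x. \<Sum>w\<in>W. c w * g w x) S = (LINT x|lborel. (\<Sum>w\<in>W. c w * (g w x * indicator S x)))"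
    unfolding mass_def by (simp add: sum_distrib_right mult.assoc)
  also have "\<dots> = (\<Sum>w\<in>W. LINT x|lborel. c w * (g w x * indicator S x))"
    using bdens_integrable[OF assms(1) assms(2)]
    by (intro Bochner_Integration.integral_sum) auto
  finally show ?thesis by (simp add: mass_def)
qed

lemma mass_disjoint_UN:
  assumes "bdens M g" "finite W" "\<And>w. w \<in> W \<Longrightarrow> I w \<in> sets borel" "disjoint_family_on I W"
  shows "(\<Sum>w\<in>W. mass g (I w)) = mass g (\<Union>w\<in>W. I w)"
proof -
  have "(\<Sum>w\<in>W. mass g (I w)) = (LINT x|lborel. (\<Sum>w\<in>W. g x * indicator (I w) x))"
    unfolding mass_def using bdens_integrable[OF assms(1) assms(3)]
    by (intro Bochner_Integration.integral_sum[symmetric]) auto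
  also have "\<dots> = mass g (\<Union>w\<in>W. I w)"
    unfolding mass_def using assms(2,4)
    by (simp add: indicator_UN_disjoint sum_distrib_left)
  finally show ?thesis .
qed

lemma mass_finite_cover:
  assumes "bdens M g" "finite W" "\<And>w. w \<in> W \<Longrightarrow> U w \<in> sets borel" "\<And>x. g x \<noteq> 0 \<Longrightarrow> x \<in> (\<Union>w\<in>W. U w)"
  shows "mass g UNIV \<le> (\<Sum>w\<in>W. mass g (U w))"
proof -
  have i: "integrable lborel (\<lambda>x. g x * indicator (U w) x)" if "w \<in> W" for w
    using bdens_integrable[OF assms(1) assms(3)[OF that]] .
  have "mass g UNIV \<le> (LINT x|lborel. (\<Sum>w\<in>W. g x * indicator (U w) x))"
    unfolding mass_def
  proof (rule Bochner_Integration.integral_mono)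
    show "integrable lborel (\<lambda>x. g x * indicator UNIV x)" by (rule bdens_integrable[OF assms(1)]) simp
    show "integrable lborel (\<lambda>x. \<Sum>w\<in>W. g x * indicator (U w) x)"
      using i by (intro Bochner_Integration.integrable_sum) 
    show "g x * indicator UNIV x \<le> (\<Sum>w\<in>W. g x * indicator (U w) x)" for x
    proof (cases "g x = 0")
      case False
      then obtain w where w: "w \<in> W" "x \<in> U w" using assms(4) by blast
      have "g x * indicator (U w) x \<le> (\<Sum>w\<in>W. g x * indicator (U w) x)"
        using bdensD(2)[OF assms(1), of x] assms(2) w(1) by (intro member_le_sum) auto
      then show ?thesis using w by simp
    qed simp
  qed
  also have "\<dots> = (\<Sum>w\<in>W. mass g (U w))"
    unfolding mass_def using i by (intro Bochner_Integration.integral_sum)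
  finally show ?thesis .
qed

text \<open>Dominated convergence. The exceptional set \<open>N\<close> is for the rationals, whose
  digit expansions stop, and for a single point that is to be removed from a support.\<close>

lemma mass_LIMSEQ:
  assumes "bdens M g" "\<And>n. S n \<in> sets borel" "countable N"
    and "\<And>x. g x \<noteq> 0 \<Longrightarrow> x \<notin> N \<Longrightarrow> eventually (\<lambda>n. x \<in> S n) sequentially"
  shows "(\<lambda>n. mass g (S n)) \<longlonglongrightarrow> mass g UNIV"
  unfolding mass_def
proof (rule integral_dominated_convergence[where w = "\<lambda>x. g x * indicator UNIV x"])
  show "integrable lborel (\<lambda>x. g x * indicator UNIV x)" by (rule bdens_integrable[OF assms(1)]) simp
  show "(\<lambda>x. g x * indicator UNIV x) \<in> borel_measurable lborel" using bdensD(1)[OF assms(1)] by simp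
  show "(\<lambda>x. g x * indicator (S n) x) \<in> borel_measurable lborel" for n
    using bdensD(1)[OF assms(1)] assms(2) by simp
  show "AE x in lborel. norm (g x * indicator (S n) x) \<le> g x * indicator UNIV x" for n
    using bdensD(2)[OF assms(1)] by (intro AE_I2) (auto simp: indicator_def)
  have "AE x in lborel. x \<notin> N"
    using countable_imp_null_set_lborel[OF assms(3)] by (rule AE_not_in)
  then show "AE x in lborel. (\<lambda>n. g x * indicator (S n) x) \<longlonglongrightarrow> g x * indicator UNIV x"
  proof eventually_elim
    case (elim x)
    show ?case
    proof (cases "g x = 0")
      case False
      have "eventually (\<lambda>n. g x * indicator (S n) x = g x * indicator UNIV x) sequentially"
        by (rule eventually_mono[OF assms(4)[OF False elim]]) simp
      then show ?thesis by (rule tendsto_eventually)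
    qed simp
  qed
qed

lemma disjoint_family_sum_at:
  fixes c :: "'i \<Rightarrow> real"
  assumes "finite W" "disjoint_family_on I W" "\<And>w. w \<in> W \<Longrightarrow> x \<in> I w \<Longrightarrow> c w \<le> E" "E \<ge> 0"
  shows "(\<Sum>w\<in>{w\<in>W. x \<in> I w}. c w) \<le> E"
proof (cases "{w\<in>W. x \<in> I w} = {}")
  case False
  then obtain w where w: "w \<in> W" "x \<in> I w" by blast
  have "{w\<in>W. x \<in> I w} = {w}" using w assms(2) by (auto simp: disjoint_family_on_def)
  then show ?thesis using assms(3)[OF w] by simp
next
  case True
  then show ?thesis using assms(4) by (simp only: sum.empty)
qed

lemma sum_Un_le:
  fixes m :: "'i \<Rightarrow> real"
  assumes "finite A" "finite B" "\<And>w. w \<in> A \<inter> B \<Longrightarrow> m w \<ge> 0"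
  shows "sum m (A \<union> B) \<le> sum m A + sum m B"
  using sum_Un[OF assms(1,2), of m] sum_nonneg[of "A \<inter> B" m, OF assms(3)] by linarith

text \<open>An interval that is met but not swallowed by \<open>[a, b]\<close> contains an endpoint, so at most two
  members of a disjoint family are of this kind.\<close>

lemma mass_mixture:
  fixes a b :: real and I :: "'i \<Rightarrow> real set"
  assumes W: "finite W" "disjoint_family_on I W" "\<And>w. w \<in> W \<Longrightarrow> is_interval (I w)"
    and g: "\<And>w. w \<in> W \<Longrightarrow> bdens (M w) (g w)" "\<And>w x. w \<in> W \<Longrightarrow> g w x \<noteq> 0 \<Longrightarrow> x \<in> I w"
      "\<And>w. w \<in> W \<Longrightarrow> mass (g w) UNIV \<le> 1" "\<And>w. w \<in> W \<Longrightarrow> c w \<ge> 0"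
    and E: "\<And>w. w \<in> W \<Longrightarrow> c w * mass (g w) {a..b} \<le> E" "E \<ge> 0"
  shows "(\<Sum>w\<in>W. c w * mass (g w) {a..b}) \<le> (\<Sum>w\<in>{w\<in>W. I w \<subseteq> {a..b}}. c w) + 2 * E"
proof -
  define m where "m w = c w * mass (g w) {a..b}" for w
  have m0: "m w \<ge> 0" if "w \<in> W" for w using mass_nonneg[OF g(1)] g(4) that by (simp add: m_def)
  have m1: "m w \<le> c w" if "w \<in> W" for w
  proof -
    have "mass (g w) {a..b} \<le> 1"
      using mass_mono[OF g(1)[OF that], of "{a..b}" UNIV] g(3)[OF that] by simp
    then show ?thesis using g(4)[OF that] mult_left_le by (simp add: m_def)
  qed
  have z: "m w = 0 \<or> I w \<subseteq> {a..b} \<or> a \<in> I w \<or> b \<in> I w" if w: "w \<in> W" for w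
  proof (cases "I w \<inter> {a..b} = {}")
    case True
    then have "mass (g w) {a..b} = mass (g w) {}"
      using g(2)[OF w] by (intro mass_cong_supp) blast
    then show ?thesis by (simp add: m_def mass_def)
  next
    case False
    then obtain x where x: "x \<in> I w" "a \<le> x" "x \<le> b" by auto
    have "a \<in> I w \<or> b \<in> I w" if "y \<in> I w" "y \<notin> {a..b}" for y
    proof (cases "y < a")
      case True
      then show ?thesis using mem_is_interval_1_I[OF W(3)[OF w] that(1) x(1), of a] x by simp
    next
      case False
      then show ?thesis using mem_is_interval_1_I[OF W(3)[OF w] x(1) that(1), of b] x that(2) by simp
    qed
    then show ?thesis by blast
  qed
  have "(\<Sum>w\<in>W. m w) = (\<Sum>w\<in>{w\<in>W. I w \<subseteq> {a..b}} \<union> ({w\<in>W. a \<in> I w} \<union> {w\<in>W. b \<in> I w}). m w)"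
    by (rule sum.mono_neutral_right) (use z W(1) in blast)+
  also have "\<dots> \<le> (\<Sum>w\<in>{w\<in>W. I w \<subseteq> {a..b}}. m w) + (\<Sum>w\<in>{w\<in>W. a \<in> I w} \<union> {w\<in>W. b \<in> I w}. m w)"
    by (rule sum_Un_le) (use W(1) m0 in auto)
  also have "(\<Sum>w\<in>{w\<in>W. a \<in> I w} \<union> {w\<in>W. b \<in> I w}. m w) \<le> (\<Sum>w\<in>{w\<in>W. a \<in> I w}. m w) + (\<Sum>w\<in>{w\<in>W. b \<in> I w}. m w)"
    by (rule sum_Un_le) (use W(1) m0 in auto)
  also have "(\<Sum>w\<in>{w\<in>W. a \<in> I w}. m w) \<le> E"
    by (rule disjoint_family_sum_at[OF W(1,2)]) (use E in \<open>auto simp: m_def\<close>)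
  also have "(\<Sum>w\<in>{w\<in>W. b \<in> I w}. m w) \<le> E"
    by (rule disjoint_family_sum_at[OF W(1,2)]) (use E in \<open>auto simp: m_def\<close>)
  also have "(\<Sum>w\<in>{w\<in>W. I w \<subseteq> {a..b}}. m w) \<le> (\<Sum>w\<in>{w\<in>W. I w \<subseteq> {a..b}}. c w)"
    using m1 by (intro sum_mono) auto
  finally show ?thesis by (simp add: m_def)
qed

section \<open>Frostman densities on cylinders\<close>

text \<open>\<open>K\<close> is a Frostman constant. Dividing by \<open>len u\<close> makes it scale
  invariant, so that one \<open>K\<close> can serve cylinders of all levels; the bound
  \<open>M\<close> is deliberately left free.\<close>

definition adm :: "real set \<Rightarrow> real \<Rightarrow> real \<Rightarrow> nat list \<Rightarrow> bool" where
  "adm T t K u \<longleftrightarrow> (\<exists>g M. bdens M g \<and> (\<forall>x. g x \<noteq> 0 \<longrightarrow> x \<in> cyl u \<inter> T) \<and> mass g UNIV = 1 \<and>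
     (\<forall>a b. a \<le> b \<longrightarrow> mass g {a..b} \<le> K * ((b - a) / len u) powr t))"

lemma adm_mono: 
  assumes "adm T t K u" "K \<le> K'" shows "adm T t K' u"
proof -
  obtain g M where g: "bdens M g" "\<forall>x. g x \<noteq> 0 \<longrightarrow> x \<in> cyl u \<inter> T" "mass g UNIV = 1"
    "\<forall>a b. a \<le> b \<longrightarrow> mass g {a..b} \<le> K * ((b - a) / len u) powr t"
    using assms(1) unfolding adm_def by blast
  have "mass g {a..b} \<le> K' * ((b - a) / len u) powr t" if "a \<le> b" for a b
    using g(4)[rule_format, OF that] mult_right_mono[OF assms(2), of "((b - a) / len u) powr t"]
    by simp
  then show ?thesis unfolding adm_def using g(1-3) by blast
qed

lemma powr_ge_self: "0 \<le> (y::real) \<Longrightarrow> y \<le> 1 \<Longrightarrow> t \<le> 1 \<Longrightarrow> y \<le> y powr t"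
  using powr_mono'[of t 1 y] by (cases "y = 0") auto

lemma powr_le_self: "1 \<le> (y::real) \<Longrightarrow> t \<le> 1 \<Longrightarrow> y powr t \<le> y"
  using powr_mono[of t 1 y] by auto

text \<open>Below relative length 1 a smaller exponent only weakens the bound; above it the total
  mass 1 suffices because \<open>K\<close> is at least 1. This brings in the exponents up to 1/2,
  for which no blocks are constructed.\<close>

lemma adm_exponent:
  assumes "adm T t' K u" "0 < t" "t \<le> t'" "1 \<le> K" "pos_word u"
  shows "adm T t K u"
proof -
  obtain g M where g: "bdens M g" "\<forall>x. g x \<noteq> 0 \<longrightarrow> x \<in> cyl u \<inter> T" "mass g UNIV = 1"
    "\<forall>a b. a \<le> b \<longrightarrow> mass g {a..b} \<le> K * ((b - a) / len u) powr t'"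
    using assms(1) unfolding adm_def by blast
  have "mass g {a..b} \<le> K * ((b - a) / len u) powr t" if ab: "a \<le> b" for a b
  proof -
    define y where "y = (b - a) / len u"
    have y: "y \<ge> 0" using ab len_pos[OF assms(5)] by (simp add: y_def)
    show ?thesis
    proof (cases "y \<le> 1")
      case True
      have "mass g {a..b} \<le> K * y powr t'" using g(4) ab by (simp add: y_def)
      also have "\<dots> \<le> K * y powr t"
        using y True assms by (intro mult_left_mono powr_mono') auto
      finally show ?thesis by (simp add: y_def)
    next
      case False
      have "mass g {a..b} \<le> 1" using mass_mono[OF g(1), of "{a..b}" UNIV] g(3) by simp
      also have "1 \<le> K * y powr t"
        using mult_mono[of 1 K 1 "y powr t"] assms False ge_one_powr_ge_zero[of y t] by simp
      finally show ?thesis by (simp add: y_def)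
    qed
  qed
  then show ?thesis unfolding adm_def using g(1-3) by blast
qed

lemma uniform_density:
  assumes lh: "0 \<le> l" "l < h" "h \<le> 1" and t: "0 < t" "t \<le> 1"
  defines "g \<equiv> \<lambda>x. 1 / (h - l) * indicator {l<..<h} x :: real"
  shows "bdens (1 / (h - l)) g" "mass g UNIV = 1"
    "a \<le> b \<Longrightarrow> mass g {a..b} \<le> ((b - a) / (h - l)) powr t"
proof -
  show bd: "bdens (1 / (h - l)) g"
    unfolding bdens_def g_def using lh by (auto simp: indicator_def)
  show m1: "mass g UNIV = 1"
    using lh by (simp add: mass_def g_def)
  assume ab: "a \<le> b"
  show "mass g {a..b} \<le> ((b - a) / (h - l)) powr t"
  proof (cases "(b - a) / (h - l) \<le> 1")
    case True
    have "mass g {a..b} \<le> 1 / (h - l) * (b - a)" by (rule mass_le_Lebesgue[OF bd ab])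
    also have "\<dots> = (b - a) / (h - l)" by simp
    also have "\<dots> \<le> ((b - a) / (h - l)) powr t"
      by (rule powr_ge_self) (use True ab lh t in auto)
    finally show ?thesis .
  next
    case False
    have "mass g {a..b} \<le> 1" using mass_mono[OF bd, of "{a..b}" UNIV] m1 by simp
    also have "1 \<le> ((b - a) / (h - l)) powr t" using False t by (intro ge_one_powr_ge_zero) auto
    finally show ?thesis .
  qed
qed

lemma adm_uniform:
  assumes "pos_word u" "cyl u \<subseteq> T" "0 < t" "t \<le> 1"
  shows "adm T t 1 u"
proof (rule cyl_eq_interval[OF assms(1)])
  fix l h assume lh: "0 \<le> l" "l < h" "h \<le> 1" "cyl u = {l<..<h}" "h - l = len u"
  define g where "g = (\<lambda>x. 1 / (h - l) * indicator {l<..<h} x :: real)"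
  note U = uniform_density[OF lh(1-3) assms(3,4), folded g_def]
  have "\<forall>x. g x \<noteq> 0 \<longrightarrow> x \<in> cyl u \<inter> T"
    using assms(2) unfolding lh(4) by (auto simp: g_def indicator_def)
  moreover have "\<forall>a b. a \<le> b \<longrightarrow> mass g {a..b} \<le> 1 * ((b - a) / len u) powr t"
    using U(3) unfolding lh(5) by simp
  ultimately show ?thesis unfolding adm_def using U(1,2) by blast
qed

lemma is_interval_cyl: "pos_word u \<Longrightarrow> is_interval (cyl u)"
  by (erule cyl_eq_interval) (simp add: is_interval_oo)

lemma disjoint_family_cyl:
  assumes "\<And>w. w \<in> W \<Longrightarrow> pos_word w" "\<And>w. w \<in> W \<Longrightarrow> length w = n"
  shows "disjoint_family_on cyl W"
  unfolding disjoint_family_on_def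
proof (intro ballI impI, rule ccontr)
  fix v w assume *: "v \<in> W" "w \<in> W" "v \<noteq> w" "cyl v \<inter> cyl w \<noteq> {}"
  then obtain x where "x \<in> cyl v" "x \<in> cyl w" by blast
  then show False using cyl_disjoint[OF assms(1)[OF *(1)] assms(1)[OF *(2)]] assms(2) * by simp
qed

section \<open>How appended digits change the Frostman constant\<close>

lemma sum_len_le:
  assumes "finite F" "\<And>w. w \<in> F \<Longrightarrow> pos_word w" "\<And>w. w \<in> F \<Longrightarrow> length w = n"
    "\<And>w. w \<in> F \<Longrightarrow> cyl w \<subseteq> {a..b}" "a \<le> b"
  shows "(\<Sum>w\<in>F. len w) \<le> b - a"
proof -
  have bd: "bdens 1 (indicator {0..1})" by (auto simp: bdens_def)
  have m: "mass (indicator {0..1}) (cyl w) = len w" if w: "w \<in> F" for w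
  proof (rule cyl_eq_interval[OF assms(2)[OF w]])
    fix l h assume lh: "0 \<le> l" "l < h" "h \<le> 1" "cyl w = {l<..<h}" "h - l = len w"
    have "mass (indicator {0..1}) (cyl w) = (LINT x|lborel. indicator {l<..<h} x)"
      unfolding mass_def lh(4) by (rule Bochner_Integration.integral_cong) (use lh in \<open>auto simp: indicator_def\<close>)
    then show ?thesis using lh by simp
  qed
  have "(\<Sum>w\<in>F. len w) = (\<Sum>w\<in>F. mass (indicator {0..1}) (cyl w))" using m by simp
  also have "\<dots> = mass (indicator {0..1}) (\<Union>w\<in>F. cyl w)"
    by (intro mass_disjoint_UN[OF bd assms(1)] borel_open open_cyl disjoint_family_cyl[OF assms(2,3)] assms(2))
  also have "\<dots> \<le> mass (indicator {0..1}) {a..b}"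
  proof (rule mass_mono[OF bd])
    show "(\<Union>w\<in>F. cyl w) \<in> sets borel"
      using assms(2) by (intro borel_open open_UN ballI open_cyl)
  qed (use assms(4) in auto)
  also have "\<dots> \<le> b - a" using mass_le_Lebesgue[OF bd assms(5)] by simp
  finally show ?thesis .
qed

text \<open>\<open>D\<close> accounts for the children that an interval swallows, \<open>E\<close>
  for each of the at most two children that it cuts. Passing from the scale of a child to that of
  \<open>u\<close> costs \<open>(len u / len (u @ w)) powr t\<close>.\<close>

lemma adm_children:
  assumes u: "pos_word u"
    and W: "finite W" "\<And>w. w \<in> W \<Longrightarrow> pos_word w" "\<And>w. w \<in> W \<Longrightarrow> length w = n"
    and p: "\<And>w. w \<in> W \<Longrightarrow> p w \<ge> 0" "(\<Sum>w\<in>W. p w) = 1"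
    and H: "\<And>w. w \<in> W \<Longrightarrow> adm T t H (u @ w)"
    and E: "\<And>w. w \<in> W \<Longrightarrow> p w * H * (len u / len (u @ w)) powr t \<le> E" "E \<ge> 0"
    and D: "\<And>a b. a \<le> b \<Longrightarrow> (\<Sum>w\<in>{w\<in>W. cyl (u @ w) \<subseteq> {a..b}}. p w) \<le> D * ((b - a) / len u) powr t"
  shows "adm T t (D + 2 * E) u"
proof -
  have "\<forall>w\<in>W. \<exists>gM. bdens (snd gM) (fst gM) \<and> (\<forall>x. fst gM x \<noteq> 0 \<longrightarrow> x \<in> cyl (u @ w) \<inter> T) \<and>
     mass (fst gM) UNIV = 1 \<and> (\<forall>a b. a \<le> b \<longrightarrow> mass (fst gM) {a..b} \<le> H * ((b - a) / len (u @ w)) powr t)"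
    using H unfolding adm_def by auto
  then obtain gM where gM: "\<And>w. w \<in> W \<Longrightarrow> bdens (snd (gM w)) (fst (gM w)) \<and>
     (\<forall>x. fst (gM w) x \<noteq> 0 \<longrightarrow> x \<in> cyl (u @ w) \<inter> T) \<and>
     mass (fst (gM w)) UNIV = 1 \<and> (\<forall>a b. a \<le> b \<longrightarrow> mass (fst (gM w)) {a..b} \<le> H * ((b - a) / len (u @ w)) powr t)"
    by (metis (lifting))
  define g where "g w = fst (gM w)" for w
  define M where "M w = snd (gM w)" for w
  have g1: "bdens (M w) (g w)" if "w \<in> W" for w using gM[OF that] by (simp add: g_def M_def)
  have g2: "x \<in> cyl (u @ w)" "x \<in> T" if "w \<in> W" "g w x \<noteq> 0" for w x
    using gM[OF that(1)] that(2) by (auto simp: g_def)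
  have g3: "mass (g w) UNIV = 1" if "w \<in> W" for w using gM[OF that] by (simp add: g_def)
  have g4: "mass (g w) {a..b} \<le> H * ((b - a) / len (u @ w)) powr t" if "w \<in> W" "a \<le> b" for w a b
    using gM[OF that(1)] that(2) by (simp add: g_def)
  define G where "G = (\<lambda>x. \<Sum>w\<in>W. p w * g w x)"
  have bG: "bdens (\<Sum>w\<in>W. p w * M w) G"
    unfolding G_def by (rule bdens_sum) (use W(1) g1 p(1) in auto)
  have mG: "mass G S = (\<Sum>w\<in>W. p w * mass (g w) S)" if "S \<in> sets borel" for S
    unfolding G_def by (rule mass_sum[OF g1 that])
  have L: "len u > 0" "\<And>w. w \<in> W \<Longrightarrow> len (u @ w) > 0" using len_pos u W(2) by auto
  have "\<forall>x. G x \<noteq> 0 \<longrightarrow> x \<in> cyl u \<inter> T"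
  proof (intro allI impI)
    fix x assume "G x \<noteq> 0"
    have "\<exists>w\<in>W. g w x \<noteq> 0"
    proof (rule ccontr)
      assume "\<not> (\<exists>w\<in>W. g w x \<noteq> 0)"
      then have "G x = 0" unfolding G_def by (intro sum.neutral) auto
      with \<open>G x \<noteq> 0\<close> show False by simp
    qed
    then obtain w where w: "w \<in> W" "g w x \<noteq> 0" by blast
    then show "x \<in> cyl u \<inter> T" using g2[OF w] cyl_append_subset[OF W(2)[OF w(1)]] by blast
  qed
  moreover have "mass G UNIV = 1" using mG[of UNIV] g3 p(2) by simp
  moreover have "mass G {a..b} \<le> (D + 2 * E) * ((b - a) / len u) powr t" if ab: "a \<le> b" for a b
  proof -
    define y where "y = ((b - a) / len u) powr t"
    have "mass G {a..b} \<le> (\<Sum>w\<in>{w\<in>W. cyl (u @ w) \<subseteq> {a..b}}. p w) + 2 * (E * y)"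
      unfolding mG[OF borel_closed[OF closed_atLeastAtMost]]
    proof (rule mass_mixture)
      show "finite W" by fact
      show "disjoint_family_on (\<lambda>w. cyl (u @ w)) W"
      proof -
        have "disjoint_family_on cyl ((@) u ` W)"
          by (rule disjoint_family_cyl[of _ "length u + n"]) (use u W in auto)
        then show ?thesis by (auto simp: disjoint_family_on_def)
      qed
      show "is_interval (cyl (u @ w))" if "w \<in> W" for w using is_interval_cyl u W(2) that by simp
      show "bdens (M w) (g w)" if "w \<in> W" for w using g1 that .
      show "x \<in> cyl (u @ w)" if "w \<in> W" "g w x \<noteq> 0" for w x using g2 that by blast
      show "mass (g w) UNIV \<le> 1" if "w \<in> W" for w using g3 that by simp
      show "0 \<le> p w" if "w \<in> W" for w using p that by simp
      show "0 \<le> E * y" using E(2) by (simp add: y_def)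
      show "p w * mass (g w) {a..b} \<le> E * y" if w: "w \<in> W" for w
      proof -
        have "(b - a) / len (u @ w) = (len u / len (u @ w)) * ((b - a) / len u)"
          using L(1) by simp
        then have "((b - a) / len (u @ w)) powr t = (len u / len (u @ w)) powr t * y"
          unfolding y_def using L(1) L(2)[OF w] ab by (simp only: powr_mult)
        then have "p w * mass (g w) {a..b} \<le> p w * (H * ((len u / len (u @ w)) powr t * y))"
          using g4[OF w ab] p(1)[OF w] by (intro mult_left_mono) auto
        also have "\<dots> \<le> E * y"
          using mult_right_mono[OF E(1)[OF w], of y] by (simp add: y_def mult_ac)
        finally show ?thesis .
      qed
    qed
    also have "\<dots> \<le> D * y + 2 * (E * y)" using D[OF ab] by (simp add: y_def)
    finally show ?thesis by (simp add: y_def algebra_simps)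
  qed
  ultimately show ?thesis unfolding adm_def using bG by blast
qed

text \<open>A uniform choice among the \<open>A\<close> digits from \<open>A\<close> to
  \<open>2 * A - 1\<close>. The term with \<open>A powr t\<close> comes from swallowed children, the
  term with \<open>A powr (2 * t - 1)\<close> from cut ones: weight \<open>1 / A\<close> times a
  change of scale of order \<open>A powr (2 * t)\<close>.\<close>

lemma adm_digits:
  assumes u: "pos_word u" and A: "A \<ge> 1" and t: "0 < t" "t \<le> 1" and h: "h \<ge> 0"
    and H: "\<And>b. A \<le> b \<Longrightarrow> adm T t h (u @ [b])"
  shows "adm T t (32 * real A powr t + 64 * real A powr (2 * t - 1) * h) u"
proof -
  define W where "W = (\<lambda>b. [b]) ` {A..<2 * A}"
  have W: "finite W" "\<And>w. w \<in> W \<Longrightarrow> pos_word w" "\<And>w. w \<in> W \<Longrightarrow> length w = 1"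
    using A by (auto simp: W_def)
  have card: "card W = A" unfolding W_def by (subst card_image) (auto simp: inj_on_def)
  have A': "real A \<ge> 1" using A by simp
  have L: "len u > 0" using len_pos u by simp
  have r: "len u / (32 * (real A)\<^sup>2) \<le> len (u @ w)" if w: "w \<in> W" for w
  proof -
    obtain b where b: "w = [b]" "A \<le> b" "b < 2 * A" using w by (auto simp: W_def)
    have "len u / (32 * (real A)\<^sup>2) = len u / (8 * (2 * real A)\<^sup>2)" by (simp add: power_mult_distrib)
    also have "\<dots> \<le> len u / (8 * (den w 0)\<^sup>2)"
      using b L A by (intro divide_left_mono mult_left_mono power_mono) auto
    also have "\<dots> \<le> len (u @ w)" by (rule len_append[OF u W(2)[OF w]])
    finally show ?thesis .
  qed
  have r': "len u / len (u @ w) \<le> 32 * (real A)\<^sup>2" if w: "w \<in> W" for w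
    using r[OF w] len_pos[of "u @ w"] u W(2)[OF w] A' by (simp add: field_simps)
  have p32: "32 powr t \<le> (32::real)" using t by (intro powr_le_self) auto
  have "adm T t (32 * real A powr t + 2 * (32 * real A powr (2 * t - 1) * h)) u"
  proof (rule adm_children[OF u W, where p = "\<lambda>_. 1 / real A" and H = h])
    show "(\<Sum>w\<in>W. 1 / real A) = 1" using card A by simp
    show "adm T t h (u @ w)" if "w \<in> W" for w using that H by (auto simp: W_def)
    show "1 / real A * h * (len u / len (u @ w)) powr t \<le> 32 * real A powr (2 * t - 1) * h" if w: "w \<in> W" for w
    proof -
      have "(len u / len (u @ w)) powr t \<le> (32 * (real A)\<^sup>2) powr t"
        using r'[OF w] L len_pos[of "u @ w"] u W(2)[OF w] t by (intro powr_mono2) auto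
      also have "\<dots> = 32 powr t * (real A)\<^sup>2 powr t" by (simp add: powr_mult)
      also have "(real A)\<^sup>2 powr t = real A powr (2 * t)"
        using A' powr_powr[of "real A" 2 t] by simp
      also have "32 powr t * real A powr (2 * t) \<le> 32 * (real A powr (2 * t))"
        using p32 by (intro mult_right_mono) auto
      also have "\<dots> = 32 * (real A powr (2 * t - 1)) * real A" using A' by (simp add: powr_diff)
      finally have "(1 / real A * h) * (len u / len (u @ w)) powr t \<le> (1 / real A * h) * (32 * (real A powr (2 * t - 1)) * real A)"
        using h by (intro mult_left_mono) auto
      also have "\<dots> = 32 * real A powr (2 * t - 1) * h" using A' by simp
      finally show ?thesis .
    qed
    show "(\<Sum>w\<in>{w\<in>W. cyl (u @ w) \<subseteq> {a..b}}. 1 / real A) \<le> 32 * real A powr t * ((b - a) / len u) powr t"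
      if ab: "a \<le> b" for a b
    proof -
      define F where "F = {w\<in>W. cyl (u @ w) \<subseteq> {a..b}}"
      define y where "y = (b - a) / len u"
      define s where "s = real (card F)"
      have F: "finite F" using W(1) by (simp add: F_def)
      have y: "y \<ge> 0" using ab L by (simp add: y_def)
      have "card F \<le> card W" unfolding F_def using W(1) by (intro card_mono) auto
      then have s: "0 \<le> s" "s \<le> real A" using card by (auto simp: s_def)
      have "s * (len u / (32 * (real A)\<^sup>2)) = (\<Sum>w\<in>F. len u / (32 * (real A)\<^sup>2))" by (simp add: s_def)
      also have "\<dots> \<le> (\<Sum>w\<in>F. len (u @ w))" using r by (intro sum_mono) (auto simp: F_def)
      also have "\<dots> = (\<Sum>w\<in>(@) u ` F. len w)" by (subst sum.reindex) (auto simp: inj_on_def)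
      also have "\<dots> \<le> b - a"
        using F u W ab by (intro sum_len_le[where n = "length u + 1"]) (auto simp: F_def)
      finally have "s * (len u / (32 * (real A)\<^sup>2)) \<le> y * len u" using L by (simp add: y_def)
      moreover have "s * (len u / (32 * (real A)\<^sup>2)) = s / real A / (32 * real A) * len u"
        by (simp add: power2_eq_square)
      ultimately have "s / real A / (32 * real A) * len u \<le> y * len u" by linarith
      then have "s / real A / (32 * real A) \<le> y" using L by (rule mult_right_le_imp_le)
      then have "s / real A \<le> 32 * real A * y"
        using A' by (subst (asm) pos_divide_le_eq) (auto simp: mult_ac)
      \<comment> \<open>The fraction \<open>s / A\<close> of swallowed children is at most 1, so it
        is bounded by its own \<open>t\<close>-th power; this turns the linear bound by length into
        one of exponent \<open>t\<close>.\<close>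
      then have "s / real A \<le> (32 * real A * y) powr t"
        using order.trans[OF powr_ge_self[of "s / real A" t] powr_mono2[of t "s / real A" "32 * real A * y"]] s A' t
        by simp
      also have "\<dots> = 32 powr t * (real A powr t * y powr t)" using A' y by (simp add: powr_mult)
      also have "\<dots> \<le> 32 * (real A powr t * y powr t)" using p32 by (intro mult_right_mono) auto
      finally show ?thesis by (simp add: F_def s_def y_def mult.assoc)
    qed
  qed (use h A in auto)
  then show ?thesis by (simp add: mult.assoc)
qed

text \<open>The weights \<open>den w 0 powr (- 2 * t) / Z\<close> cancel the change of scale, so
  every cut child contributes at most \<open>8 * H / Z\<close>. For swallowed children a crude
  \<open>D\<close> is enough: an interval containing a child has relative length at least
  \<open>1 / D\<close>, and the total mass is 1. \<open>D\<close> depends on \<open>W\<close> and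
  \<open>t\<close>, but not on \<open>T\<close>, \<open>H\<close> or \<open>u\<close>.\<close>

lemma adm_blocks:
  assumes W: "finite W" "W \<noteq> {}" "\<And>w. w \<in> W \<Longrightarrow> pos_word w" "\<And>w. w \<in> W \<Longrightarrow> length w = n"
    and t: "0 < t" "t \<le> 1"
  defines "Z \<equiv> \<Sum>w\<in>W. den w 0 powr (- 2 * t)"
  shows "\<exists>D\<ge>1. \<forall>T H u. pos_word u \<longrightarrow> H \<ge> 0 \<longrightarrow> (\<forall>w\<in>W. adm T t H (u @ w)) \<longrightarrow> adm T t (D + 16 * H / Z) u"
proof -
  define D where "D = (\<Sum>w\<in>W. 8 * (den w 0)\<^sup>2)"
  have d: "den w 0 \<ge> 1" if "w \<in> W" for w using den_ge_1 W(3)[OF that] by simp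
  have DD: "8 * (den w 0)\<^sup>2 \<le> D" if "w \<in> W" for w
    unfolding D_def using W(1) that by (intro member_le_sum) auto
  obtain w0 where w0: "w0 \<in> W" using W(2) by blast
  have "1 \<le> 8 * (den w0 0)\<^sup>2" using one_le_power[OF d[OF w0], of 2] by linarith
  then have D1: "D \<ge> 1" using DD[OF w0] by simp
  have Z: "Z > 0" 
    unfolding Z_def
  proof (rule sum_pos)
    fix w assume "w \<in> W"
    from d[OF this] show "0 < den w 0 powr (- 2 * t)" by simp
  qed (use W in auto)
  have "adm T t (D + 2 * (8 * H / Z)) u"
    if u: "pos_word u" and H: "H \<ge> 0" "\<forall>w\<in>W. adm T t H (u @ w)" for T H u
  proof (rule adm_children[OF u W(1,3,4), where p = "\<lambda>w. den w 0 powr (- 2 * t) / Z" and H = H])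
    have L: "len u > 0" using len_pos u by simp
    have r: "len u / len (u @ w) \<le> 8 * (den w 0)\<^sup>2" if w: "w \<in> W" for w
      using len_append[OF u W(3)[OF w]] len_pos[of "u @ w"] u W(3)[OF w] d[OF w]
      by (simp add: field_simps)
    have pw: "(8 * (den w 0)\<^sup>2) powr t = 8 powr t * den w 0 powr (2 * t)" if w: "w \<in> W" for w
      using d[OF w] powr_powr[of "den w 0" 2 t] by (simp add: powr_mult)
    have p8: "8 powr t \<le> (8::real)" using t by (intro powr_le_self) auto
    show "0 \<le> den w 0 powr (- 2 * t) / Z" for w using Z by simp
    show sum1: "(\<Sum>w\<in>W. den w 0 powr (- 2 * t) / Z) = 1"
      using Z unfolding sum_divide_distrib[symmetric] Z_def[symmetric] by simp
    show "adm T t H (u @ w)" if "w \<in> W" for w using H that by blast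
    show "0 \<le> 8 * H / Z" using H Z by simp
    show "den w 0 powr (- 2 * t) / Z * H * (len u / len (u @ w)) powr t \<le> 8 * H / Z" if w: "w \<in> W" for w
    proof -
      have "(len u / len (u @ w)) powr t \<le> (8 * (den w 0)\<^sup>2) powr t"
        using r[OF w] L len_pos[of "u @ w"] u W(3)[OF w] t by (intro powr_mono2) auto
      also have "\<dots> \<le> 8 * den w 0 powr (2 * t)"
        unfolding pw[OF w] using p8 by (intro mult_right_mono) auto
      finally have "(den w 0 powr (- 2 * t) / Z * H) * (len u / len (u @ w)) powr t
          \<le> (den w 0 powr (- 2 * t) / Z * H) * (8 * den w 0 powr (2 * t))"
        using Z H by (intro mult_left_mono) auto
      also have "\<dots> = 8 * H / Z * (den w 0 powr (- 2 * t) * den w 0 powr (2 * t))" by simp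
      also have "den w 0 powr (- 2 * t) * den w 0 powr (2 * t) = 1"
        using d[OF w] by (simp flip: powr_add)
      finally show ?thesis by simp
    qed
    show "(\<Sum>w\<in>{w\<in>W. cyl (u @ w) \<subseteq> {a..b}}. den w 0 powr (- 2 * t) / Z) \<le> D * ((b - a) / len u) powr t"
      if ab: "a \<le> b" for a b
    proof (cases "{w\<in>W. cyl (u @ w) \<subseteq> {a..b}} = {}")
      case True
      then show ?thesis using D1 by (simp only: sum.empty) simp
    next
      case False
      then obtain w where w: "w \<in> W" "cyl (u @ w) \<subseteq> {a..b}" by blast
      define y where "y = (b - a) / len u"
      have y: "y \<ge> 0" using ab L by (simp add: y_def)
      have "(\<Sum>w\<in>{w\<in>W. cyl (u @ w) \<subseteq> {a..b}}. den w 0 powr (- 2 * t) / Z)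
          \<le> (\<Sum>w\<in>W. den w 0 powr (- 2 * t) / Z)"
        using W(1) Z by (intro sum_mono2) auto
      also note sum1
      also have "1 \<le> D * y powr t"
      proof -
        have "len (u @ w) \<le> b - a"
          using sum_len_le[of "{u @ w}" "length u + n" a b] w u W(3,4)[OF w(1)] ab by simp
        then have "len u / (8 * (den w 0)\<^sup>2) \<le> y * len u"
          using len_append[OF u W(3)[OF w(1)]] L by (simp add: y_def)
        then have "len u * 1 \<le> len u * (8 * (den w 0)\<^sup>2 * y)" 
          using d[OF w(1)] by (subst (asm) pos_divide_le_eq) (auto simp: mult_ac)
        then have "1 \<le> 8 * (den w 0)\<^sup>2 * y" using L by (simp only: mult_le_cancel_left_pos)
        then have "1 \<le> (8 * (den w 0)\<^sup>2 * y) powr t" using t by (intro ge_one_powr_ge_zero) auto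
        also have "\<dots> = (8 * (den w 0)\<^sup>2) powr t * y powr t" using y by (intro powr_mult)
        also have "\<dots> \<le> D * y powr t"
        proof (rule mult_right_mono)
          have "(8 * (den w 0)\<^sup>2) powr t \<le> 8 * (den w 0)\<^sup>2"
            using one_le_power[OF d[OF w(1)], of 2] t by (intro powr_le_self) auto
          then show "(8 * (den w 0)\<^sup>2) powr t \<le> D" using DD[OF w(1)] by linarith
        qed simp
        finally show ?thesis .
      qed
      finally show ?thesis by (simp add: y_def)
    qed
  qed
  then show ?thesis using D1 by (intro exI[of _ D]) (auto simp: algebra_simps)
qed

text \<open>The block costs form a geometric series with sum at most \<open>2 * D\<close>, and the
  constant \<open>h\<close> at the last level is damped by \<open>\<theta> ^ k\<close>.\<close>

lemma adm_iterate:
  assumes D: "D \<ge> 1" "0 \<le> \<theta>" "\<theta> \<le> 1/2" "h \<ge> 0"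
    and W: "\<And>w. w \<in> W \<Longrightarrow> pos_word w" "\<And>w. w \<in> W \<Longrightarrow> length w = n"
    and block: "\<And>H u. pos_word u \<Longrightarrow> H \<ge> 0 \<Longrightarrow> (\<And>w. w \<in> W \<Longrightarrow> adm T t H (u @ w)) \<Longrightarrow> adm T t (D + \<theta> * H) u"
    and u: "pos_word u"
    and h: "\<And>v. pos_word v \<Longrightarrow> length v = length u + k * n \<Longrightarrow> adm T t h v"
  shows "adm T t (2 * D + \<theta> ^ k * h) u"
  using u h
proof (induction k arbitrary: u)
  case 0
  then have "adm T t h u" by simp
  then show ?case by (rule adm_mono) (use D in simp)
next
  case (Suc k)
  have "adm T t (D + \<theta> * (2 * D + \<theta> ^ k * h)) u"
  proof (rule block)
    show "pos_word u" by fact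
    show "0 \<le> 2 * D + \<theta> ^ k * h" using D by simp
    show "adm T t (2 * D + \<theta> ^ k * h) (u @ w)" if "w \<in> W" for w
    proof (rule Suc.IH)
      show "pos_word (u @ w)" using Suc.prems(1) W(1)[OF that] by simp
      show "adm T t h v" if "pos_word v" "length v = length (u @ w) + k * n" for v
        using Suc.prems(2)[OF that(1)] that(2) W(2)[OF \<open>w \<in> W\<close>] by simp
    qed
  qed
  then show ?case
  proof (rule adm_mono)
    have "\<theta> * (2 * D) \<le> 1/2 * (2 * D)" using D by (intro mult_right_mono) auto
    then show "D + \<theta> * (2 * D + \<theta> ^ k * h) \<le> 2 * D + \<theta> ^ Suc k * h"
      by (simp add: algebra_simps)
  qed
qed

text \<open>Choosing the digit after \<open>u\<close> of size \<open>x\<close> leaves the cost \<open>x powr (2 * t - 1)\<close> per chosen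
  digit; the sizes \<open>x\<close>, \<open>x powr r\<close>, \<open>x powr (r ^ 2)\<close>, \<open>\<dots>\<close> with \<open>r = (1 - t) / t\<close> balance the costs
  of all \<open>m\<close> digits.\<close>

lemma adm_big_digits:
  assumes t: "1/2 < t" "t < 1"
  defines "r \<equiv> (1 - t) / t"
  shows "\<exists>c\<ge>0. \<forall>T x u. x \<ge> 1 \<longrightarrow> pos_word u \<longrightarrow>
    (\<forall>bs. pos_word bs \<and> length bs = m \<and> real (prod_list bs) \<ge> x powr (\<Sum>i<m. r ^ i) \<longrightarrow> cyl (u @ bs) \<subseteq> T) \<longrightarrow>
    adm T t (c * x powr t) u"
proof (induction m)
  case 0
  have "adm T t (1 * x powr t) u" if "x \<ge> 1" "pos_word u" "cyl u \<subseteq> T" for T x u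
  proof (rule adm_mono)
    show "adm T t 1 u" by (rule adm_uniform) (use that t in auto)
    show "1 \<le> 1 * x powr t" using ge_one_powr_ge_zero[of x t] that t by simp
  qed
  note base = this
  show ?case
  proof (intro exI[of _ 1] conjI allI impI)
    show "adm T t (1 * x powr t) u" if "1 \<le> x" "pos_word u"
      "\<forall>bs. pos_word bs \<and> length bs = 0 \<and> x powr (\<Sum>i<0. r ^ i) \<le> real (prod_list bs) \<longrightarrow> cyl (u @ bs) \<subseteq> T" for T x u
      using that(3)[rule_format, of "[]"] that(1) by (intro base that(1,2)) simp
  qed simp
next
  case (Suc m)
  then obtain c where c: "c \<ge> 0" and IH: "\<forall>T x u. x \<ge> 1 \<longrightarrow> pos_word u \<longrightarrow>
    (\<forall>bs. pos_word bs \<and> length bs = m \<and> real (prod_list bs) \<ge> x powr (\<Sum>i<m. r ^ i) \<longrightarrow> cyl (u @ bs) \<subseteq> T) \<longrightarrow>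
    adm T t (c * x powr t) u"
    by (elim exE conjE)
  have r: "0 < r" using t by (simp add: r_def)
  have "adm T t ((64 + 128 * c) * x powr t) u"
    if x: "x \<ge> 1" and u: "pos_word u" and
      T: "\<And>bs. pos_word bs \<Longrightarrow> length bs = Suc m \<Longrightarrow> real (prod_list bs) \<ge> x powr (\<Sum>i<Suc m. r ^ i) \<Longrightarrow> cyl (u @ bs) \<subseteq> T"
    for T x u
  proof -
    \<comment> \<open>Rounding up keeps \<open>x \<le> A\<close>, which the lower bound on the
      product of digits needs; \<open>A \<le> 2 * x\<close> costs only constant factors.\<close>
    define A where "A = nat \<lceil>x\<rceil>"
    have "x \<le> of_int \<lceil>x\<rceil>" "of_int \<lceil>x\<rceil> \<le> x + 1" by linarith+
    moreover have "real A = of_int \<lceil>x\<rceil>" using x by (simp add: A_def)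
    ultimately have A: "x \<le> real A" "real A \<le> 2 * x" using x by linarith+
    then have "A \<ge> 1" using x by linarith
    note A = A this
    define H where "H = c * (x powr r) powr t"
    have H0: "H \<ge> 0" using c by (simp add: H_def)
    have "adm T t (32 * real A powr t + 64 * real A powr (2 * t - 1) * H) u"
    proof (rule adm_digits[OF u A(3)])
      fix b assume b: "A \<le> b"
      have xb: "x \<le> real b" using A(1) b by linarith
      show "adm T t H (u @ [b])"
        unfolding H_def
      proof (rule IH[rule_format])
        show "1 \<le> x powr r" using x r by (intro ge_one_powr_ge_zero) auto
        show "pos_word (u @ [b])" using u b A(3) by simp
        fix bs assume "pos_word bs \<and> length bs = m \<and> (x powr r) powr (\<Sum>i<m. r ^ i) \<le> real (prod_list bs)"
        then have bs: "pos_word bs" "length bs = m" "(x powr r) powr (\<Sum>i<m. r ^ i) \<le> real (prod_list bs)"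
          by blast+
        have "(\<Sum>i<Suc m. r ^ i) = 1 + r * (\<Sum>i<m. r ^ i)"
          unfolding sum.lessThan_Suc_shift sum_distrib_left by simp
        then have "x powr (\<Sum>i<Suc m. r ^ i) = x * (x powr r) powr (\<Sum>i<m. r ^ i)"
          using x by (simp only: powr_add powr_powr powr_one)
        also have "\<dots> \<le> real b * real (prod_list bs)"
          using xb bs(3) x by (intro mult_mono) auto
        also have "\<dots> = real (prod_list (b # bs))" by simp
        finally have "x powr (\<Sum>i<Suc m. r ^ i) \<le> real (prod_list (b # bs))" .
        moreover have "pos_word (b # bs)" "length (b # bs) = Suc m" using bs(1,2) b A(3) by simp_all
        ultimately have "cyl (u @ (b # bs)) \<subseteq> T" by (intro T)
        then show "cyl ((u @ [b]) @ bs) \<subseteq> T" by (simp only: append.simps append_assoc)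
      qed
    qed (use t H0 in auto)
    then show ?thesis
    proof (rule adm_mono)
      have a: "real A powr s \<le> 2 * x powr s" if "0 \<le> s" "s \<le> 1" for s
      proof -
        have "real A powr s \<le> (2 * x) powr s" using A that by (intro powr_mono2) auto
        also have "\<dots> = 2 powr s * x powr s" using x by (simp add: powr_mult)
        also have "\<dots> \<le> 2 * x powr s" using powr_le_self[of 2 s] that by (intro mult_right_mono) auto
        finally show ?thesis .
      qed
      \<comment> \<open>The balance that fixes \<open>r\<close>: the exponent
        \<open>2 * t - 1\<close> of this digit and \<open>r * t\<close> of the remaining ones add up
        to \<open>t\<close>.\<close>
      have e: "x powr (2 * t - 1) * (x powr r) powr t = x powr t"
      proof -
        have "2 * t - 1 + r * t = t" using t by (simp add: r_def)
        then show ?thesis by (simp only: powr_powr powr_add[symmetric])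
      qed
      have "64 * real A powr (2 * t - 1) * H \<le> 64 * (2 * x powr (2 * t - 1)) * H"
        using a[of "2 * t - 1"] t H0 by (intro mult_right_mono mult_left_mono) auto
      also have "\<dots> = 128 * c * (x powr (2 * t - 1) * (x powr r) powr t)" by (simp add: H_def)
      finally have "64 * real A powr (2 * t - 1) * H \<le> 128 * c * x powr t" unfolding e .
      moreover have "32 * real A powr t \<le> 64 * x powr t" using a[of t] t by simp
      ultimately show "32 * real A powr t + 64 * real A powr (2 * t - 1) * H \<le> (64 + 128 * c) * x powr t"
        by (simp add: algebra_simps)
    qed
  qed
  note step = this
  show ?case
  proof (intro exI[of _ "64 + 128 * c"] conjI allI impI)
    show "0 \<le> 64 + 128 * c" using c by simp
    fix T x u
    assume "1 \<le> x" "pos_word u" and T: "\<forall>bs. pos_word bs \<and> length bs = Suc m \<and>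
      x powr (\<Sum>i<Suc m. r ^ i) \<le> real (prod_list bs) \<longrightarrow> cyl (u @ bs) \<subseteq> T"
    then show "adm T t ((64 + 128 * c) * x powr t) u"
      by (intro step T[rule_format] conjI)
  qed
qed

text \<open>The only property of the target that enters the construction of densities: once the last
  \<open>m\<close> digits are large enough, the whole remaining cylinder lies in \<open>T\<close>
  and can carry the uniform density.\<close>

definition deep_big :: "nat \<Rightarrow> real \<Rightarrow> nat \<Rightarrow> real set \<Rightarrow> bool" where
  "deep_big m B n0 T \<longleftrightarrow> (\<forall>w bs. pos_word w \<and> pos_word bs \<and> length w \<ge> n0 \<and> length bs = m \<and>
     real (prod_list bs) \<ge> B ^ length w \<longrightarrow> cyl (w @ bs) \<subseteq> T)"

text \<open>\<open>K\<close> depends on \<open>W\<close> but not on \<open>T\<close>,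
  \<open>n0\<close> or \<open>u\<close>. Each further block of length \<open>n\<close> raises the
  cost of the large digits by \<open>B powr (G * n)\<close> and damps it by \<open>\<theta>\<close>;
  the hypothesis on the weights makes the product of the two at most 1/2.\<close>

lemma adm_deep:
  assumes t: "1/2 < t" "t < 1" and m: "m \<ge> 1" and B: "B > 1"
  defines "G \<equiv> t / (\<Sum>i<m. ((1 - t) / t) ^ i)"
  assumes W: "finite W" "W \<noteq> {}" "\<And>w. w \<in> W \<Longrightarrow> pos_word w" "\<And>w. w \<in> W \<Longrightarrow> length w = n"
    and Z: "32 * B powr (G * real n) \<le> (\<Sum>w\<in>W. den w 0 powr (- 2 * t))"
  shows "\<exists>K\<ge>1. \<forall>T n0 u. deep_big m B n0 T \<and> pos_word u \<and> length u \<ge> n0 \<longrightarrow> adm T t K u"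
proof -
  define S where "S = (\<Sum>i<m. ((1 - t) / t) ^ i)"
  define Z where "Z = (\<Sum>w\<in>W. den w 0 powr (- 2 * t))"
  have "S \<ge> (\<Sum>i\<in>{0}. ((1 - t) / t) ^ i)"
    unfolding S_def using m t by (intro sum_mono2) auto
  then have S: "S \<ge> 1" by simp
  have G: "G > 0" "G / t * S = 1" using S t by (auto simp: G_def S_def[symmetric])
  have BG: "B powr (G * real n) \<ge> 1" using B G(1) by (intro ge_one_powr_ge_zero) auto
  have Z0: "Z \<ge> 32 * B powr (G * real n)" "Z \<ge> 32" using Z BG unfolding Z_def by linarith+
  \<comment> \<open>\<open>16 / Z\<close> is the damping factor supplied by
    \<open>adm_blocks\<close>; against the 32 in the hypothesis this leaves 1/2.\<close>
  define \<theta> where "\<theta> = 16 / Z"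
  have th: "0 \<le> \<theta>" "\<theta> \<le> 1/2" "\<theta> * B powr (G * real n) \<le> 1/2"
    using Z0 by (auto simp: \<theta>_def field_simps)
  have "\<exists>D\<ge>1. \<forall>T H u. pos_word u \<longrightarrow> H \<ge> 0 \<longrightarrow> (\<forall>w\<in>W. adm T t H (u @ w)) \<longrightarrow> adm T t (D + 16 * H / Z) u"
    unfolding Z_def by (rule adm_blocks[OF W]) (use t in auto)
  then obtain D where D: "D \<ge> 1"
    and D2: "\<forall>T H u. pos_word u \<longrightarrow> H \<ge> 0 \<longrightarrow> (\<forall>w\<in>W. adm T t H (u @ w)) \<longrightarrow> adm T t (D + 16 * H / Z) u"
    by blast
  from adm_big_digits[OF t, of m] obtain c where c: "c \<ge> 0" and c2: "\<forall>T x u. x \<ge> 1 \<longrightarrow> pos_word u \<longrightarrow>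
    (\<forall>bs. pos_word bs \<and> length bs = m \<and> real (prod_list bs) \<ge> x powr S \<longrightarrow> cyl (u @ bs) \<subseteq> T) \<longrightarrow>
    adm T t (c * x powr t) u"
    unfolding S_def by (elim exE conjE)
  have "adm T t (2 * D + 1) u" if T: "deep_big m B n0 T" and u: "pos_word u" "length u \<ge> n0" for T n0 u
  proof -
    define C where "C = c * B powr (G * real (length u))"
    have C: "C \<ge> 0" using c by (simp add: C_def)
    \<comment> \<open>The number of blocks may depend on \<open>u\<close>: it has to absorb
      \<open>C\<close>, for which there is no bound uniform in \<open>length u\<close>.\<close>
    obtain k where k: "(1/2) ^ k < 1 / (C + 1)"
      using real_arch_pow_inv[of "1 / (C + 1)" "1/2"] C by auto
    have k': "(1/2) ^ k * C \<le> 1"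
    proof -
      have "(1/2) ^ k * (C + 1) < 1" using k C by (simp add: pos_less_divide_eq)
      moreover have "(0::real) \<le> (1/2) ^ k" by simp
      ultimately show ?thesis unfolding distrib_left by linarith
    qed
    define N where "N = length u + k * n"
    \<comment> \<open>Chosen so that \<open>x powr S = B ^ N\<close>, the size that the product of
      the large digits after level \<open>N\<close> must reach.\<close>
    define x where "x = B powr (G / t * real N)"
    have x: "x \<ge> 1" "x powr t = B powr (G * real N)" "x powr S = B ^ N"
    proof -
      show "x \<ge> 1" unfolding x_def using B G(1) t by (intro ge_one_powr_ge_zero) (simp_all add: divide_nonneg_nonneg)
      show "x powr t = B powr (G * real N)" using t by (simp add: x_def powr_powr)
      have "G / t * real N * S = (G / t * S) * real N" by (simp only: mult_ac)
      then have "G / t * real N * S = real N" unfolding G(2) by simp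
      then show "x powr S = B ^ N" using B by (simp only: x_def powr_powr powr_realpow)
    qed
    have "adm T t (2 * D + \<theta> ^ k * (c * x powr t)) u"
    proof (rule adm_iterate[OF D th(1,2) _ W(3,4)])
      show "0 \<le> c * x powr t" using c by simp
      show "adm T t (D + \<theta> * H) u" if "pos_word u" "H \<ge> 0" "\<And>w. w \<in> W \<Longrightarrow> adm T t H (u @ w)" for H u
        using D2[rule_format, OF that] by (simp add: \<theta>_def)
      show "pos_word u" by fact
      show "adm T t (c * x powr t) v" if v: "pos_word v" "length v = length u + k * n" for v
      proof (rule c2[rule_format, OF x(1) v(1)])
        fix bs assume "pos_word bs \<and> length bs = m \<and> x powr S \<le> real (prod_list bs)"
        moreover have "n0 \<le> length v" using v(2) u(2) by simp
        ultimately show "cyl (v @ bs) \<subseteq> T"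
          using v(1) unfolding x(3) N_def v(2)[symmetric]
          by (intro T[unfolded deep_big_def, rule_format] conjI) auto
      qed
    qed 
    then show ?thesis
    proof (rule adm_mono)
      have "B powr (G * real N) = B powr (G * real (length u)) * (B powr (G * real n)) ^ k"
        using B by (simp add: N_def distrib_left powr_add powr_power mult_ac)
      then have "\<theta> ^ k * (c * x powr t) = C * (\<theta> * B powr (G * real n)) ^ k"
        unfolding x(2) C_def power_mult_distrib by (simp only: mult_ac)
      also have "\<dots> \<le> C * (1/2) ^ k"
        using C th by (intro mult_left_mono power_mono) auto
      finally show "2 * D + \<theta> ^ k * (c * x powr t) \<le> 2 * D + 1" using k' by (simp add: mult.commute)
    qed
  qed
  then show ?thesis using D by (intro exI[of _ "2 * D + 1"]) auto
qed

section \<open>The pressure function\<close>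

definition words :: "nat \<Rightarrow> nat list set" where
  "words n = {w. length w = n \<and> (\<forall>a\<in>set w. a \<ge> 1)}"

lemma words_iff: "w \<in> words n \<longleftrightarrow> length w = n \<and> pos_word w"
  by (auto simp: words_def pos_word_def)

lemma words_take_drop:
  assumes "w \<in> words (n + k)"
  shows "take n w \<in> words n" "drop n w \<in> words k"
  using assms by (auto simp: words_def dest: in_set_takeD in_set_dropD)

text \<open>For \<open>t\<close> in a bounded range of nonnegative numbers this is comparable to
  \<open>len w powr t\<close>, and to the \<open>t\<close>-th power of \<open>1 / |(G^n)'|\<close>
  on the cylinder of \<open>w\<close>, where \<open>n = length w\<close>.\<close>

definition wt :: "real \<Rightarrow> nat list \<Rightarrow> real" where
  "wt t w = den w 0 powr (- 2 * t)"

text \<open>For positive \<open>n\<close> and \<open>t \<le> 1/2\<close> the series diverges and the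
  value is the default 0.\<close>

definition Zsum :: "nat \<Rightarrow> real \<Rightarrow> real" where
  "Zsum n t = infsum (wt t) (words n)"

lemma wt_nonneg [simp]: "wt t w \<ge> 0" by (simp add: wt_def)

lemma wt_pos: "pos_word w \<Longrightarrow> wt t w > 0"
  using den_pos[of w 0] by (simp add: wt_def)

lemma wt_antimono: "pos_word w \<Longrightarrow> s \<le> t \<Longrightarrow> wt t w \<le> wt s w"
  unfolding wt_def using den_ge_1[of w 0] by (intro powr_mono) auto

lemma wt_append_le:
  assumes "pos_word u" "pos_word v" "t \<ge> 0"
  shows "wt t (u @ v) \<le> wt t u * wt t v"
proof -
  have d: "den u 0 > 0" "den v 0 > 0" using den_pos assms by auto
  have "wt t (u @ v) \<le> (den u 0 * den v 0) powr (- 2 * t)"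
    unfolding wt_def using den_append_bounds[OF assms(1,2)] d assms(3) by (intro powr_mono2') auto
  then show ?thesis using d by (simp add: wt_def powr_mult)
qed

lemma wt_append_ge:
  assumes "pos_word u" "pos_word v" "t \<ge> 0"
  shows "wt t u * wt t v \<le> 4 powr t * wt t (u @ v)"
proof -
  have d: "den u 0 > 0" "den v 0 > 0" "den (u @ v) 0 > 0" using den_pos assms by auto
  have e: "4 powr t * 2 powr (- 2 * t) = (1::real)"
    using powr_powr[of 2 2 t] by (simp flip: powr_add)
  have "2 powr (- 2 * t) * (wt t u * wt t v) = (2 * den u 0 * den v 0) powr (- 2 * t)"
    using d by (simp add: wt_def powr_mult)
  also have "\<dots> \<le> wt t (u @ v)"
    unfolding wt_def using den_append_bounds[OF assms(1,2)] d assms(3) by (intro powr_mono2') auto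
  finally have "4 powr t * (2 powr (- 2 * t) * (wt t u * wt t v)) \<le> 4 powr t * wt t (u @ v)"
    by (intro mult_left_mono) auto
  then show ?thesis by (simp only: mult.assoc[symmetric] e mult_1)
qed

text \<open>Stated for finite sets of words because it also serves in the proof of summability. A
  word is determined by its two parts, so the sum over \<open>F\<close> embeds into a product of
  sums.\<close>

lemma finite_sum_append_le:
  assumes "finite F" "F \<subseteq> words (n + k)" "t \<ge> 0"
  shows "sum (wt t) F \<le> sum (wt t) (take n ` F) * sum (wt t) (drop n ` F)"
proof -
  have "sum (wt t) F \<le> (\<Sum>w\<in>F. wt t (take n w) * wt t (drop n w))"
  proof (rule sum_mono)
    fix w assume "w \<in> F"
    then have "pos_word (take n w)" "pos_word (drop n w)"
      using words_take_drop[of w n k] assms(2) by (auto simp: words_iff)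
    from wt_append_le[OF this assms(3)] show "wt t w \<le> wt t (take n w) * wt t (drop n w)" by simp
  qed
  also have "\<dots> = (\<Sum>p\<in>(\<lambda>w. (take n w, drop n w)) ` F. wt t (fst p) * wt t (snd p))"
  proof (subst sum.reindex)
    show "inj_on (\<lambda>w. (take n w, drop n w)) F"
      by (rule inj_onI) (metis append_take_drop_id prod.inject)
  qed simp
  also have "\<dots> \<le> (\<Sum>p\<in>take n ` F \<times> drop n ` F. wt t (fst p) * wt t (snd p))"
    using assms(1) by (intro sum_mono2) auto
  also have "\<dots> = sum (wt t) (take n ` F) * sum (wt t) (drop n ` F)"
    by (simp add: sum_product sum.cartesian_product case_prod_beta)
  finally show ?thesis .
qed

lemma summable_wt:
  assumes t: "t > 1/2"
  shows "wt t summable_on words n"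
proof -
  \<comment> \<open>The index 0 contributes nothing because \<open>0 powr x = 0\<close>;
    \<open>c\<close> dominates the weights of all one-digit words.\<close>
  define c where "c = (\<Sum>k. real k powr (- 2 * t))"
  have s: "summable (\<lambda>k. real k powr (- 2 * t))" using t by (subst summable_real_powr_iff) simp
  have c0: "c \<ge> 0" unfolding c_def by (intro suminf_nonneg s) simp
  have F: "sum (wt t) F \<le> c ^ n" if "finite F" "F \<subseteq> words n" for F n
    using that
  proof (induction n arbitrary: F)
    case 0
    then have "F \<subseteq> {[]}" by (auto simp: words_def)
    then consider "F = {}" | "F = {[]}" by blast
    then show ?case by cases (auto simp: wt_def)
  next
    case (Suc n)
    have "sum (wt t) F \<le> sum (wt t) (take 1 ` F) * sum (wt t) (drop 1 ` F)"
      by (rule finite_sum_append_le[of _ 1 n]) (use Suc.prems t in auto)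
    also have "\<dots> \<le> c * c ^ n"
    proof (rule mult_mono)
      have "drop 1 ` F \<subseteq> words n"
        using Suc.prems(2) words_take_drop(2)[of _ 1 n] by auto
      then show "sum (wt t) (drop 1 ` F) \<le> c ^ n"
        by (intro Suc.IH) (use Suc.prems(1) in auto)
      have sub: "take 1 ` F \<subseteq> (\<lambda>a. [a]) ` (hd ` F)"
      proof
        fix v assume "v \<in> take 1 ` F"
        then obtain w where w: "w \<in> F" "v = take 1 w" by blast
        then have "length w = Suc n" using Suc.prems(2) by (auto simp: words_def)
        then have "v = [hd w]" using w(2) by (cases w) auto
        then show "v \<in> (\<lambda>a. [a]) ` (hd ` F)" using w(1) by blast
      qed
      have "sum (wt t) (take 1 ` F) \<le> sum (wt t) ((\<lambda>a. [a]) ` (hd ` F))"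
        using Suc.prems(1) sub by (intro sum_mono2) auto
      also have "\<dots> = (\<Sum>a\<in>hd ` F. real a powr (- 2 * t))"
        by (subst sum.reindex) (auto simp: inj_on_def wt_def)
      also have "\<dots> \<le> c"
        unfolding c_def using Suc.prems(1) by (intro sum_le_suminf s) auto
      finally show "sum (wt t) (take 1 ` F) \<le> c" .
    qed (use c0 in \<open>auto intro!: sum_nonneg\<close>)
    finally show ?case by simp
  qed
  show ?thesis
  proof (rule nonneg_bdd_above_summable_on)
    show "bdd_above (sum (wt t) ` {F. F \<subseteq> words n \<and> finite F})"
      using F by (intro bdd_aboveI[of _ "c ^ n"]) auto
  qed simp
qed

lemma sum_le_Zsum: "t > 1/2 \<Longrightarrow> finite F \<Longrightarrow> F \<subseteq> words n \<Longrightarrow> sum (wt t) F \<le> Zsum n t"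
  unfolding Zsum_def by (intro finite_sum_le_infsum summable_wt) auto

lemma Zsum_le: "t > 1/2 \<Longrightarrow> (\<And>F. finite F \<Longrightarrow> F \<subseteq> words n \<Longrightarrow> sum (wt t) F \<le> b) \<Longrightarrow> Zsum n t \<le> b"
  unfolding Zsum_def by (intro infsum_le_finite_sums summable_wt) auto

section \<open>Almost multiplicative partition sums and their growth rate\<close>

lemma Zsum_pos:
  assumes "t > 1/2" shows "Zsum n t > 0"
proof -
  have p: "pos_word (replicate n 1)" by (auto simp: pos_word_def)
  then have "sum (wt t) {replicate n 1} \<le> Zsum n t"
    using assms by (intro sum_le_Zsum) (auto simp: words_iff)
  then show ?thesis using wt_pos[OF p, of t] by simp
qed

lemma Zsum_submult:
  assumes "t > 1/2" shows "Zsum (n + k) t \<le> Zsum n t * Zsum k t"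
proof (rule Zsum_le[OF assms])
  fix F assume F: "finite F" "F \<subseteq> words (n + k)"
  have "sum (wt t) F \<le> sum (wt t) (take n ` F) * sum (wt t) (drop n ` F)"
    by (rule finite_sum_append_le) (use F assms in auto)
  also have "\<dots> \<le> Zsum n t * Zsum k t"
  proof (rule mult_mono)
    show "sum (wt t) (take n ` F) \<le> Zsum n t"
      using F words_take_drop(1)[of _ n k] by (intro sum_le_Zsum assms) auto
    show "sum (wt t) (drop n ` F) \<le> Zsum k t"
      using F words_take_drop(2)[of _ n k] by (intro sum_le_Zsum assms) auto
  qed (use Zsum_pos[OF assms, of n] in \<open>auto intro!: sum_nonneg\<close>)
  finally show "sum (wt t) F \<le> Zsum n t * Zsum k t" .
qed

lemma Zsum_supermult:
  assumes "t > 1/2" shows "Zsum n t * Zsum k t \<le> 4 powr t * Zsum (n + k) t"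
proof -
  have "sum (wt t) F * sum (wt t) G \<le> 4 powr t * Zsum (n + k) t"
    if F: "finite F" "F \<subseteq> words n" and G: "finite G" "G \<subseteq> words k" for F G
  proof -
    have pos: "pos_word u" "length u = n" if "u \<in> F" for u using that F by (auto simp: words_iff)
    have pos': "pos_word v" "length v = k" if "v \<in> G" for v using that G by (auto simp: words_iff)
    have "sum (wt t) F * sum (wt t) G = (\<Sum>p\<in>F \<times> G. wt t (fst p) * wt t (snd p))"
      by (simp add: sum_product sum.cartesian_product case_prod_beta)
    also have "\<dots> \<le> (\<Sum>p\<in>F \<times> G. 4 powr t * wt t (fst p @ snd p))"
      using assms pos pos' by (intro sum_mono wt_append_ge) auto
    also have "\<dots> = 4 powr t * (\<Sum>p\<in>F \<times> G. wt t (fst p @ snd p))" by (simp add: sum_distrib_left)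
    also have "(\<Sum>p\<in>F \<times> G. wt t (fst p @ snd p)) = sum (wt t) ((\<lambda>p. fst p @ snd p) ` (F \<times> G))"
      using pos(2) pos'(2) by (subst sum.reindex) (auto simp: inj_on_def)
    also have "\<dots> \<le> Zsum (n + k) t"
      using F G by (intro sum_le_Zsum assms) (auto simp: words_iff pos pos')
    finally show ?thesis by simp
  qed
  note * = this
  \<comment> \<open>The suprema are taken one factor at a time; dividing by the sum over
    \<open>F\<close> requires it to be nonzero.\<close>
  have "sum (wt t) F * Zsum k t \<le> 4 powr t * Zsum (n + k) t" if F: "finite F" "F \<subseteq> words n" for F
  proof (cases "sum (wt t) F = 0")
    case True
    then show ?thesis using Zsum_pos[OF assms, of "n + k"] by simp
  next
    case False
    then have p: "sum (wt t) F > 0" using sum_nonneg[of F "wt t"] by simp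
    have "Zsum k t \<le> 4 powr t * Zsum (n + k) t / sum (wt t) F"
      using *[OF F] p by (intro Zsum_le assms) (simp add: field_simps)
    then show ?thesis using p by (simp add: field_simps)
  qed
  then have "Zsum n t \<le> 4 powr t * Zsum (n + k) t / Zsum k t"
    using Zsum_pos[OF assms, of k] by (intro Zsum_le assms) (simp add: field_simps)
  then show ?thesis using Zsum_pos[OF assms, of k] by (simp add: field_simps)
qed

text \<open>Almost additivity on both sides gives more than Fekete's lemma: the rate
  \<open>c / n\<close>. It makes the convergence uniform in the exponent, whence continuity of the
  pressure, and lets the single level \<open>n = 1\<close> decide its sign near 1/2.\<close>

lemma almost_additive_limit:
  fixes a :: "nat \<Rightarrow> real"
  assumes "\<And>n k. \<bar>a (n + k) - a n - a k\<bar> \<le> c"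
  shows "\<exists>P. \<forall>n\<ge>1. \<bar>a n / real n - P\<bar> \<le> c / real n"
proof -
  have c0: "c \<ge> 0" using assms[of 0 0] by linarith
  have mult: "\<bar>a (n * k) - real k * a n\<bar> \<le> real k * c" if "k \<ge> 1" for n k
    using that
  proof (induction k rule: dec_induct)
    case base
    then show ?case using c0 by simp
  next
    case (step k)
    have "a (n * Suc k) - real (Suc k) * a n = (a (n * k + n) - a (n * k) - a n) + (a (n * k) - real k * a n)"
      by (simp add: algebra_simps)
    also have "\<bar>\<dots>\<bar> \<le> c + real k * c" using assms[of "n * k" n] step.IH by linarith
    finally show ?case by (simp add: algebra_simps)
  qed
  have cmp: "\<bar>a n / real n - a k / real k\<bar> \<le> c / real n + c / real k" if "n \<ge> 1" "k \<ge> 1" for n k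
  proof -
    \<comment> \<open>Both averages are compared with the average at the common multiple
      \<open>n * k\<close>.\<close>
    have 1: "\<bar>a (n * k) / (real n * real k) - a n / real n\<bar> \<le> c / real n" if "n \<ge> 1" "k \<ge> 1" for n k
    proof -
      have "a (n * k) / (real n * real k) - a n / real n = (a (n * k) - real k * a n) / (real n * real k)"
        using that by (simp add: field_simps)
      then have "\<bar>a (n * k) / (real n * real k) - a n / real n\<bar> = \<bar>a (n * k) - real k * a n\<bar> / (real n * real k)"
        using that by (simp add: abs_divide abs_mult)
      also have "\<dots> \<le> real k * c / (real n * real k)"
        using mult[OF that(2), of n] by (intro divide_right_mono) auto
      also have "\<dots> = c / real n" using that by simp
      finally show ?thesis .
    qed
    have tri: "\<bar>z - x\<bar> \<le> p \<Longrightarrow> \<bar>z - y\<bar> \<le> q \<Longrightarrow> \<bar>x - y\<bar> \<le> p + q" for x y z p q :: real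
      by linarith
    show ?thesis
      by (rule tri[OF 1[OF that]]) (use 1[OF that(2,1)] in \<open>simp only: mult.commute\<close>)
  qed
  have lim0: "(\<lambda>n. c / real n) \<longlonglongrightarrow> 0" by (rule lim_const_over_n)
  have "Cauchy (\<lambda>n. a n / real n)"
  proof (rule metric_CauchyI)
    fix e :: real assume "e > 0"
    then have "eventually (\<lambda>n. c / real n < e / 2) sequentially"
      using order_tendstoD(2)[OF lim0, of "e / 2"] by simp
    then obtain N where N: "\<And>n. n \<ge> N \<Longrightarrow> c / real n < e / 2"
      by (auto simp: eventually_sequentially)
    show "\<exists>M. \<forall>m\<ge>M. \<forall>n\<ge>M. dist (a m / real m) (a n / real n) < e"
    proof (intro exI allI impI)
      fix m n assume mn: "m \<ge> max 1 N" "n \<ge> max 1 N"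
      have half: "x \<le> p + q \<Longrightarrow> p < e / 2 \<Longrightarrow> q < e / 2 \<Longrightarrow> x < e" for x p q by linarith
      show "dist (a m / real m) (a n / real n) < e"
        unfolding dist_real_def by (rule half[OF cmp N N]) (use mn in auto)
    qed
  qed
  then obtain P where P: "(\<lambda>n. a n / real n) \<longlonglongrightarrow> P" using Cauchy_convergent convergent_def by blast
  have "\<bar>a n / real n - P\<bar> \<le> c / real n" if n: "n \<ge> 1" for n
  proof (rule tendsto_le)
    show "(\<lambda>k. c / real n + c / real k) \<longlonglongrightarrow> c / real n" using tendsto_add[OF tendsto_const lim0] by simp
    show "(\<lambda>k. \<bar>a n / real n - a k / real k\<bar>) \<longlonglongrightarrow> \<bar>a n / real n - P\<bar>"
      by (intro tendsto_intros P)
    show "eventually (\<lambda>k. \<bar>a n / real n - a k / real k\<bar> \<le> c / real n + c / real k) sequentially"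
      using eventually_ge_at_top[of 1] by eventually_elim (use cmp n in auto)
  qed simp
  then show ?thesis by blast
qed

text \<open>The limit exists for \<open>1/2 < t \<le> 1\<close>; outside this range \<open>pr t\<close> is a junk value.\<close>

definition pr :: "real \<Rightarrow> real" where
  "pr t = (SOME P. \<forall>n\<ge>1. \<bar>ln (Zsum n t) / real n - P\<bar> \<le> ln 4 / real n)"

text \<open>The bound \<open>t \<le> 1\<close> makes the error independent of \<open>t\<close>,
  since the distortion factor \<open>4 powr t\<close> is then at most 4.\<close>

lemma pr_approx:
  assumes t: "1/2 < t" "t \<le> 1" and "n \<ge> 1"
  shows "\<bar>ln (Zsum n t) / real n - pr t\<bar> \<le> ln 4 / real n"
proof -
  have "\<bar>ln (Zsum (n + k) t) - ln (Zsum n t) - ln (Zsum k t)\<bar> \<le> ln 4" for n k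
  proof -
    have p: "Zsum (n + k) t > 0" "Zsum n t > 0" "Zsum k t > 0" using Zsum_pos t by auto
    have "ln (Zsum (n + k) t) \<le> ln (Zsum n t * Zsum k t)"
      using Zsum_submult[OF t(1)] p by simp
    then have 1: "ln (Zsum (n + k) t) \<le> ln (Zsum n t) + ln (Zsum k t)" using p by (simp add: ln_mult)
    have "ln (Zsum n t * Zsum k t) \<le> ln (4 powr t * Zsum (n + k) t)"
      using Zsum_supermult[OF t(1), of n k] p by simp
    then have 2: "ln (Zsum n t) + ln (Zsum k t) \<le> t * ln 4 + ln (Zsum (n + k) t)"
      using p by (simp add: ln_mult ln_powr)
    have "t * ln 4 \<le> 1 * ln (4::real)" using t by (intro mult_right_mono) auto
    then show ?thesis using 1 2 by linarith
  qed
  from almost_additive_limit[of "\<lambda>n. ln (Zsum n t)", OF this]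
  have "\<forall>n\<ge>1. \<bar>ln (Zsum n t) / real n - pr t\<bar> \<le> ln 4 / real n"
    unfolding pr_def by (rule someI_ex)
  then show ?thesis using assms(3) by blast
qed

text \<open>On \<open>{t0..1}\<close> every term is dominated by its value at \<open>t0\<close>,
  where the series converges, so the Weierstrass test applies.\<close>

lemma continuous_on_Zsum:
  assumes "1/2 < t0"
  shows "continuous_on {t0..1} (Zsum n)"
proof (rule uniform_limit_theorem)
  show "uniform_limit {t0..1} (\<lambda>F t. \<Sum>w\<in>F. wt t w) (Zsum n) (finite_subsets_at_top (words n))"
    unfolding Zsum_def
    by (rule Weierstrass_m_test_general[OF _ summable_wt[OF assms]])
       (auto simp: words_iff intro: wt_antimono)
  show "eventually (\<lambda>F. continuous_on {t0..1} (\<lambda>t. \<Sum>w\<in>F. wt t w)) (finite_subsets_at_top (words n))"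
  proof (rule eventually_finite_subsets_at_top_weakI)
    fix F assume "finite F" "F \<subseteq> words n"
    show "continuous_on {t0..1} (\<lambda>t. \<Sum>w\<in>F. wt t w)"
      unfolding wt_def using \<open>F \<subseteq> words n\<close> den_pos
      by (intro continuous_intros) (force simp: words_iff)+
  qed
qed simp

lemma continuous_on_pr:
  assumes "1/2 < t0"
  shows "continuous_on {t0..1} pr"
proof (rule uniform_limit_theorem)
  show "uniform_limit {t0..1} (\<lambda>n t. ln (Zsum n t) / real n) pr sequentially"
  proof (rule uniform_limitI)
    fix e :: real assume "e > 0"
    have "(\<lambda>n. ln 4 / real n) \<longlonglongrightarrow> 0" by (rule lim_const_over_n)
    from order_tendstoD(2)[OF this \<open>e > 0\<close>]
    show "\<forall>\<^sub>F n in sequentially. \<forall>t\<in>{t0..1}. dist (ln (Zsum n t) / real n) (pr t) < e"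
      using eventually_ge_at_top[of 1]
    proof eventually_elim
      case (elim n)
      show ?case
      proof
        fix t assume "t \<in> {t0..1}"
        then have "\<bar>ln (Zsum n t) / real n - pr t\<bar> \<le> ln 4 / real n"
          using assms elim(2) by (intro pr_approx) auto
        then show "dist (ln (Zsum n t) / real n) (pr t) < e"
          unfolding dist_real_def using elim(1) by linarith
      qed
    qed
  qed
  have "Zsum n t \<noteq> 0" if "t \<in> {t0..1}" for n t using Zsum_pos[of t n] that assms by simp
  then show "\<forall>\<^sub>F n in sequentially. continuous_on {t0..1} (\<lambda>t. ln (Zsum n t) / real n)"
    by (intro eventually_mono[OF eventually_gt_at_top[of 0]] continuous_intros continuous_on_Zsum assms) auto
qed simp

section \<open>The exponent function and the zero of the pressure equation\<close>

definition gbal :: "nat \<Rightarrow> real \<Rightarrow> real" where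
  "gbal m t = t / (\<Sum>i<m. ((1 - t) / t) ^ i)"

lemma gbal_sum_ge_1:
  fixes t :: real
  assumes "m \<ge> 1" "1/2 < t" "t \<le> 1" shows "(\<Sum>i<m. ((1 - t) / t) ^ i) \<ge> 1"
proof -
  have "(\<Sum>i<m. ((1 - t) / t) ^ i) \<ge> (\<Sum>i\<in>{0}. ((1 - t) / t) ^ i)"
    using assms by (intro sum_mono2) auto
  then show ?thesis by simp
qed

text \<open>A geometric sum with ratio \<open>r = (1 - u) / u < 1\<close>. In the form
  \<open>gbal\<close> the denominator is at least 1, from which positivity, the bound 1 and
  continuity follow directly.\<close>

lemma g_exponent_eq_gbal:
  assumes "1/2 < u" "u < 1" "m \<ge> 1"
  shows "g_exponent m u = gbal m u"
proof -
  define r where "r = (1 - u) / u"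
  have r: "0 < r" "r < 1" using assms by (auto simp: r_def)
  have "r ^ m \<le> r ^ 1" using r assms(3) by (intro power_decreasing) auto
  then have rm: "1 - r ^ m > 0" using r by simp
  have e1: "2 * u - 1 = u * (1 - r)" using assms by (simp add: r_def field_simps)
  have e2: "u ^ m - (1 - u) ^ m = u ^ m * (1 - r ^ m)"
    using assms by (simp add: r_def field_simps)
  have "(\<Sum>i<m. r ^ i) = (1 - r ^ m) / (1 - r)" using r by (simp add: sum_gp_strict)
  then show ?thesis
    unfolding g_exponent_def gbal_def r_def[symmetric] e1 e2 using assms r rm by simp
qed

lemma gbal_bounds:
  assumes "1/2 < t" "t \<le> 1" "m \<ge> 1"
  shows "0 < gbal m t" "gbal m t \<le> 1"
proof -
  note S = gbal_sum_ge_1[OF assms(3,1,2)]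
  show "0 < gbal m t" unfolding gbal_def using S assms by (intro divide_pos_pos) auto
  show "gbal m t \<le> 1" unfolding gbal_def using S assms by (subst divide_le_eq_1_pos) auto
qed

lemma continuous_on_gbal:
  assumes "1/2 < t0" "m \<ge> 1"
  shows "continuous_on {t0..1} (gbal m)"
  unfolding gbal_def
proof (intro continuous_intros ballI)
  fix t assume "t \<in> {t0..1}"
  then show "(\<Sum>i<m. ((1 - t) / t) ^ i) \<noteq> 0" "t \<noteq> 0"
    using gbal_sum_ge_1[OF assms(2), of t] assms by auto
qed

text \<open>At exponent 1 the weights are at most twice the lengths of disjoint subintervals of
  \<open>(0, 1)\<close>.\<close>

lemma Zsum_1_le: "Zsum n 1 \<le> 2"
proof (rule Zsum_le)
  fix F assume F: "finite F" "F \<subseteq> words n"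
  have pw: "pos_word w" "length w = n" if "w \<in> F" for w using that F by (auto simp: words_iff)
  have "sum (wt 1) F \<le> (\<Sum>w\<in>F. 2 * len w)"
  proof (rule sum_mono)
    fix w assume w: "w \<in> F"
    have "wt 1 w = 1 / (den w 0)\<^sup>2"
      using den_pos[OF pw(1)[OF w], of 0] by (simp add: wt_def powr_minus_divide)
    then show "wt 1 w \<le> 2 * len w" using len_bounds(1)[OF pw(1)[OF w]] by simp
  qed
  also have "\<dots> = 2 * (\<Sum>w\<in>F. len w)" by (simp add: sum_distrib_left)
  also have "(\<Sum>w\<in>F. len w) \<le> 1 - 0"
  proof (rule sum_len_le[OF F(1) pw])
    show "cyl w \<subseteq> {0..1}" if "w \<in> F" for w using cyl_subset_01[OF pw(1)[OF that]] by auto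
  qed auto
  finally show "sum (wt 1) F \<le> 2" by simp
qed simp

lemma pr_1_le: "pr 1 \<le> 0"
proof (rule LIMSEQ_le_const)
  show "(\<lambda>n. (ln 2 + ln 4) / real n) \<longlonglongrightarrow> 0" by (rule lim_const_over_n)
  show "\<exists>N. \<forall>n\<ge>N. pr 1 \<le> (ln 2 + ln 4) / real n"
  proof (intro exI allI impI)
    fix n :: nat assume n: "n \<ge> 1"
    have "ln (Zsum n 1) \<le> ln 2" using Zsum_1_le[of n] Zsum_pos[of 1 n] by simp
    then have "ln (Zsum n 1) / real n \<le> ln 2 / real n" by (intro divide_right_mono) auto
    moreover have "\<bar>ln (Zsum n 1) / real n - pr 1\<bar> \<le> ln 4 / real n" using n by (intro pr_approx) auto
    moreover have "x \<le> a \<Longrightarrow> \<bar>x - p\<bar> \<le> b \<Longrightarrow> p \<le> a + b" for x a p b :: real by linarith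
    ultimately have "pr 1 \<le> ln 2 / real n + ln 4 / real n" by blast
    then show "pr 1 \<le> (ln 2 + ln 4) / real n" by (simp add: add_divide_distrib)
  qed
qed

text \<open>At \<open>t = 1/2\<close> the one-digit words give the harmonic series. A finite partial
  sum exceeding \<open>4 * B\<close> stays that large slightly to the right of 1/2; the factor 4
  pays for the error in \<open>pr_approx\<close> at \<open>n = 1\<close>.\<close>

lemma pr_large_near_half:
  assumes "B > 1"
  shows "\<exists>t0. 1/2 < t0 \<and> t0 < 1 \<and> (\<forall>t. 1/2 < t \<and> t \<le> t0 \<longrightarrow> pr t > ln B)"
proof -
  have "\<exists>M. 4 * B < (\<Sum>k\<le>M. real k powr (-1))"
  proof (rule ccontr)
    assume "\<not> ?thesis"
    then have "summable (\<lambda>k. real k powr (-1))"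
      by (intro bounded_imp_summable[of _ "4 * B"]) (auto simp: not_less)
    then show False by (subst (asm) summable_real_powr_iff) simp
  qed
  then obtain M where M: "4 * B < (\<Sum>k\<le>M. real k powr (-1))" by blast
  define f where "f t = (\<Sum>k\<in>{1..M}. real k powr (- 2 * t))" for t
  have "(\<Sum>k\<le>M. real k powr (-1)) = f (1/2)"
    unfolding f_def by (simp, rule sum.mono_neutral_cong_right) (auto simp: not_le)
  with M have "4 * B < f (1/2)" by simp
  moreover have "(f \<longlongrightarrow> f (1/2)) (at_right (1/2))"
    unfolding f_def by (intro tendsto_intros) auto
  ultimately have "eventually (\<lambda>t. 4 * B < f t) (at_right (1/2))" by (simp add: order_tendstoD(1))
  then obtain b where b: "b > 1/2" "\<And>t. 1/2 < t \<Longrightarrow> t < b \<Longrightarrow> 4 * B < f t"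
    by (auto simp: eventually_at_right_field)
  define t0 where "t0 = (1/2 + min b 1) / 2"
  have t0: "1/2 < t0" "t0 < 1" "t0 < b" using b(1) by (auto simp: t0_def)
  have "pr t > ln B" if t: "1/2 < t" "t \<le> t0" for t
  proof -
    have "f t = sum (wt t) ((\<lambda>a. [a]) ` {1..M})"
      by (subst sum.reindex) (auto simp: inj_on_def wt_def f_def)
    also have "\<dots> \<le> Zsum 1 t" using t by (intro sum_le_Zsum) (auto simp: words_def)
    finally have "4 * B < Zsum 1 t" using b(2)[of t] t t0 by linarith
    then have "ln (4 * B) < ln (Zsum 1 t)" using assms by simp
    then have "ln 4 + ln B < ln (Zsum 1 t)" using assms by (simp add: ln_mult)
    moreover have "\<bar>ln (Zsum 1 t) / real 1 - pr t\<bar> \<le> ln 4 / real 1" using t t0 by (intro pr_approx) auto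
    ultimately show ?thesis unfolding of_nat_1 div_by_1 by linarith
  qed
  then show ?thesis using t0 by blast
qed

text \<open>Taking the smallest zero of \<open>pr t - gbal m t * ln B\<close> makes this difference positive below it
  without any monotonicity of \<open>gbal\<close>.\<close>

lemma pressure_zero:
  assumes "B > 1" "m \<ge> 1"
  shows "\<exists>u. 1/2 < u \<and> u < 1 \<and> pr u = gbal m u * ln B \<and> (\<forall>t. 1/2 < t \<and> t < u \<longrightarrow> pr t > gbal m t * ln B)"
proof -
  have lB: "ln B > 0" using assms by simp
  obtain t0 where t0: "1/2 < t0" "t0 < 1" "\<And>t. 1/2 < t \<Longrightarrow> t \<le> t0 \<Longrightarrow> pr t > ln B"
    using pr_large_near_half[OF assms(1)] by blast
  define h where "h t = pr t - gbal m t * ln B" for t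
  have ch: "continuous_on {t0..1} h"
    unfolding h_def by (intro continuous_intros continuous_on_pr continuous_on_gbal t0 assms)
  have h0: "h t > 0" if "1/2 < t" "t \<le> t0" for t
  proof -
    have "gbal m t * ln B \<le> 1 * ln B"
      using gbal_bounds(2)[of t m] that t0 assms lB by (intro mult_right_mono) auto
    then show ?thesis using t0(3)[OF that] unfolding h_def by linarith
  qed
  have g1: "gbal m 1 = 1"
  proof -
    have "(\<Sum>i<m. (0::real) ^ i) = 1" using assms(2) by (simp add: sum_gp_strict)
    then show ?thesis by (simp add: gbal_def)
  qed
  have h1: "h 1 < 0" using pr_1_le lB by (simp add: h_def g1)
  define S where "S = {t \<in> {t0..1}. h t \<le> 0}"
  have "closed S"
    unfolding S_def by (intro continuous_on_closed_Collect_le ch continuous_on_const closed_atLeastAtMost)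
  moreover have "S \<noteq> {}" "bdd_below S" using h1 t0 by (auto simp: S_def intro!: bdd_belowI[of _ t0])
  ultimately have uS: "Inf S \<in> S" by (intro closed_contains_Inf)
  define u where "u = Inf S"
  have u: "t0 \<le> u" "u \<le> 1" "h u \<le> 0" using uS by (auto simp: S_def u_def)
  have ut0: "t0 < u" using u h0[of t0] t0 by (cases "u = t0") auto
  have pos: "h t > 0" if "1/2 < t" "t < u" for t
  proof (cases "t \<le> t0")
    case False
    have "t \<notin> S" using that(2) \<open>bdd_below S\<close> cInf_lower[of t S] by (auto simp: u_def)
    then show ?thesis using False that(2) u(2) by (auto simp: S_def)
  qed (use that h0 in blast)
  \<comment> \<open>At the infimum only \<open>h u \<le> 0\<close> is known so far. The intermediate
    value theorem gives a zero in \<open>[t0, u]\<close>, and positivity below \<open>u\<close>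
    forces it to be \<open>u\<close>.\<close>
  have "\<exists>z\<ge>t0. z \<le> u \<and> h z = 0"
    by (rule IVT2') (use u h0[of t0] t0 continuous_on_subset[OF ch] in auto)
  then obtain z where z: "t0 \<le> z" "z \<le> u" "h z = 0" by blast
  have "z = u" using pos[of z] z t0 by force
  then have hu: "h u = 0" using z by simp
  then have "u \<noteq> 1" using h1 by auto
  then show ?thesis
    using hu pos u ut0 t0 by (intro exI[of _ u]) (auto simp: h_def)
qed

section \<open>Birkhoff sums and the pressure of the potential\<close>

lemma deriv_gauss_map:
  assumes "x \<in> {0<..<1} - \<rat>"
  shows "deriv gauss_map x = - 1 / x\<^sup>2"
proof -
  define k where "k = nat \<lfloor>1 / x\<rfloor>"
  define n where "n = real k"
  have n1: "n \<ge> 1" using gauss_irrational(2)[OF assms] unfolding n_def k_def by linarith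
  have e: "1 / (n + gauss_map x) = x" using gauss_irrational(3)[OF assms] unfolding n_def k_def .
  have G: "0 < gauss_map x" "gauss_map x < 1" using gauss_irrational(1)[OF assms] by auto
  \<comment> \<open>The branch of the Gauss map through \<open>x\<close>; an irrational point lies
    in its interior, where the map is \<open>1 / y - n\<close>.\<close>
  define S where "S = {1 / (n + 1)<..<1 / n}"
  have xS: "x \<in> S"
  proof -
    have "1 / (n + 1) < 1 / (n + gauss_map x)" "1 / (n + gauss_map x) < 1 / n"
      using n1 G by (auto intro!: divide_strict_left_mono)
    then show ?thesis unfolding e S_def by simp
  qed
  have eq: "1 / y - n = gauss_map y" if y: "y \<in> S" for y
  proof -
    have y0: "y > 0" using y n1 by (auto simp: S_def intro: less_trans[rotated])
    have "n < 1 / y" "1 / y < n + 1" using y y0 n1 by (auto simp: S_def field_simps)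
    then have "\<lfloor>1 / y\<rfloor> = int k" by (simp add: n_def floor_eq_iff)
    then show ?thesis using y0 by (simp add: gauss_map_def frac_def n_def)
  qed
  have x0: "x \<noteq> 0" using assms by auto
  have "((\<lambda>y. 1 / y - n) has_field_derivative - 1 / x\<^sup>2) (at x)"
    using x0 by (auto intro!: derivative_eq_intros simp: power2_eq_square)
  then have "(gauss_map has_field_derivative - 1 / x\<^sup>2) (at x)"
    by (rule has_field_derivative_transform_within_open[OF _ _ xS eq]) (simp_all add: S_def)
  then show ?thesis by (rule DERIV_imp_deriv)
qed

lemma sum_ln_cf:
  assumes "pos_word w" "0 < z" "z < 1"
  shows "(\<Sum>k<length w. ln (cf (drop k w) z)) = - ln (den w z)"
  using assms(1)
proof (induction w)
  case (Cons a w)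
  have p: "real a + cf w z > 0" "den w z > 0"
    using Cons.prems cf_01[of w z] den_pos[of w z] assms by auto
  have "(\<Sum>k<length (a # w). ln (cf (drop k (a # w)) z)) =
      ln (cf (a # w) z) + (\<Sum>k<length w. ln (cf (drop k w) z))"
    unfolding length_Cons sum.lessThan_Suc_shift by simp
  then show ?case using Cons p by (simp add: ln_div ln_mult)
qed simp

text \<open>\<open>|G'(v)|\<close> is \<open>1 / v^2\<close>, so multiplying along the orbit gives
  exactly \<open>den w z powr (- 2 * u)\<close> times \<open>exp (- c * n)\<close>. The unknown tail
  \<open>z\<close> costs at most \<open>2 powr (2 * u)\<close>, hence at most 4.\<close>

lemma exp_birkhoff_sum:
  fixes u c :: real
  defines "\<phi> \<equiv> \<lambda>x. - u * ln \<bar>deriv gauss_map x\<bar> - c"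
  assumes w: "w \<in> words n" and x: "x \<in> cylinder w" and u: "0 \<le> u" "u \<le> 1"
  shows "exp (birkhoff_sum \<phi> n x) \<le> wt u w * exp (- c * real n)"
    "wt u w * exp (- c * real n) / 4 \<le> exp (birkhoff_sum \<phi> n x)"
proof -
  have x01: "x \<in> {0<..<1} - \<rat>" and len: "length w = n" and pw: "pos_word w"
    using x w by (auto simp: cylinder_def words_iff)
  have "digits n x = w"
    using x len by (intro nth_equalityI) (auto simp: digits_def cylinder_def)
  define z where "z = (gauss_map ^^ n) x"
  have z: "0 < z" "z < 1" "cf w z = x"
    using gauss_funpow_irrational[OF x01, of n] digits_props(3)[OF x01, of n] \<open>digits n x = w\<close>
    by (auto simp: z_def)
  have ph: "\<phi> ((gauss_map ^^ k) x) = 2 * u * ln (cf (drop k w) z) - c" if k: "k < n" for k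
  proof -
    define v where "v = (gauss_map ^^ k) x"
    have v: "v \<in> {0<..<1} - \<rat>" unfolding v_def by (rule gauss_funpow_irrational[OF x01])
    have "v = cf (drop k w) z"
      using gauss_funpow_cf[OF pw z(1,2), of k] k len by (simp add: z(3) v_def)
    moreover have "\<phi> v = 2 * u * ln v - c"
      using v by (simp add: \<phi>_def deriv_gauss_map[OF v] ln_div ln_realpow)
    ultimately show ?thesis by (simp add: v_def)
  qed
  have "birkhoff_sum \<phi> n x = (\<Sum>k<n. 2 * u * ln (cf (drop k w) z) - c)"
    unfolding birkhoff_sum_def using ph by (intro sum.cong) auto
  also have "\<dots> = 2 * u * (\<Sum>k<n. ln (cf (drop k w) z)) - c * real n"
    by (simp add: sum_subtractf sum_distrib_left)
  also have "\<dots> = - 2 * u * ln (den w z) - c * real n"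
    using sum_ln_cf[OF pw z(1,2)] len by simp
  finally have b: "exp (birkhoff_sum \<phi> n x) = den w z powr (- 2 * u) * exp (- c * real n)"
    using den_pos[OF pw, of z] z(1) by (simp add: powr_def flip: exp_add)
  have d: "den w 0 > 0" "den w 0 \<le> den w z" "den w z \<le> 2 * den w 0"
    using den_pos[OF pw, of 0] den_mono[OF pw, of 0 z] den_distortion[OF pw, of z] z by auto
  have "den w z powr (- 2 * u) \<le> wt u w"
    unfolding wt_def using d u by (intro powr_mono2') auto
  then show "exp (birkhoff_sum \<phi> n x) \<le> wt u w * exp (- c * real n)"
    unfolding b by (intro mult_right_mono) auto
  have "2 powr (-2) \<le> 2 powr (- 2 * u)" using u by (intro powr_mono) auto
  then have "1 / 4 * wt u w \<le> 2 powr (- 2 * u) * wt u w" by (intro mult_right_mono) (auto simp: powr_minus)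
  also have "\<dots> = (2 * den w 0) powr (- 2 * u)" using d by (simp add: wt_def powr_mult)
  also have "\<dots> \<le> den w z powr (- 2 * u)" using d u by (intro powr_mono2') auto
  finally have "(1 / 4 * wt u w) * exp (- c * real n) \<le> den w z powr (- 2 * u) * exp (- c * real n)"
    by (intro mult_right_mono) auto
  then show "wt u w * exp (- c * real n) / 4 \<le> exp (birkhoff_sum \<phi> n x)"
    unfolding b by simp
qed

lemma infsum_ennreal_eq:
  assumes "f summable_on A" "\<And>x. x \<in> A \<Longrightarrow> f x \<ge> 0"
  shows "infsum (\<lambda>x. ennreal (f x)) A = ennreal (infsum f A)"
proof -
  have "infsum (\<lambda>x. ennreal (f x)) A = (SUP F\<in>{F. finite F \<and> F \<subseteq> A}. \<Sum>x\<in>F. ennreal (f x))"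
    by (rule nonneg_infsum_complete) simp
  also have "\<dots> = (SUP F\<in>{F. finite F \<and> F \<subseteq> A}. ennreal (sum f F))"
    using assms(2) by (intro SUP_cong refl sum_ennreal) auto
  also have "\<dots> = ennreal (infsum f A)"
    using infsum_nonneg_is_SUPREMUM_ennreal[OF assms] by simp
  finally show ?thesis .
qed

text \<open>The bounds of \<open>exp_birkhoff_sum\<close> hold at every point of the cylinder, so
  each choice of sample points changes the logarithm of the partition sum by at most
  \<open>ln 4\<close>, which disappears after division by \<open>n\<close>.\<close>

lemma has_pressure_pr:
  assumes u: "1/2 < u" "u \<le> 1"
  shows "has_pressure (\<lambda>x. - u * ln \<bar>deriv gauss_map x\<bar> - c) (ereal (pr u - c))"
  unfolding has_pressure_def
proof (intro allI impI)
  fix y :: "nat list \<Rightarrow> real"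
  define \<phi> where "\<phi> = (\<lambda>x. - u * ln \<bar>deriv gauss_map x\<bar> - c)"
  assume "\<forall>as. (\<forall>a\<in>set as. 1 \<le> a) \<longrightarrow> y as \<in> cylinder as"
  then have y: "y w \<in> cylinder w" if "w \<in> words n" for w n using that by (auto simp: words_def)
  define s where "s n w = exp (birkhoff_sum \<phi> n (y w))" for n w
  define S where "S n = infsum (s n) (words n)" for n
  have up: "s n w \<le> wt u w * exp (- c * real n)" and lo: "wt u w * exp (- c * real n) / 4 \<le> s n w"
    if "w \<in> words n" for n w
    using exp_birkhoff_sum[OF that y[OF that], of u c] u unfolding s_def \<phi>_def by auto
  have sm: "(\<lambda>w. wt u w * exp (- c * real n)) summable_on words n" for n
    by (intro summable_on_cmult_left summable_wt u)
  have ss: "s n summable_on words n" for n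
    by (rule summable_on_comparison_test[OF sm[of n]]) (use up in \<open>auto simp: s_def\<close>)
  have S_up: "S n \<le> Zsum n u * exp (- c * real n)" for n
    unfolding S_def Zsum_def infsum_cmult_left'[symmetric] by (intro infsum_mono ss sm up)
  have S_lo: "Zsum n u * (exp (- c * real n) / 4) \<le> S n" for n
    unfolding S_def Zsum_def infsum_cmult_left'[symmetric]
    by (intro infsum_mono ss summable_on_cmult_left summable_wt u) (use lo in auto)
  have Z: "Zsum n u > 0" for n using Zsum_pos u by simp
  have "Zsum n u * (exp (- c * real n) / 4) > 0" for n using Z by simp
  then have Spos: "S n > 0" for n using S_lo[of n] less_le_trans by blast
  have ps: "partition_sum \<phi> y n = ennreal (S n)" for n
    unfolding partition_sum_def words_def[symmetric] S_def s_def[symmetric]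
    by (rule infsum_ennreal_eq[OF ss]) (simp add: s_def)
  have lnS: "\<bar>ln (S n) - (ln (Zsum n u) - c * real n)\<bar> \<le> ln 4" for n
  proof -
    have "ln (S n) \<le> ln (Zsum n u * exp (- c * real n))" using S_up[of n] Spos[of n] Z[of n] by simp
    also have "\<dots> = ln (Zsum n u) - c * real n" using Z[of n] by (simp add: ln_mult)
    finally have 1: "ln (S n) \<le> ln (Zsum n u) - c * real n" .
    have "ln (Zsum n u * (exp (- c * real n) / 4)) \<le> ln (S n)" using S_lo[of n] Spos[of n] Z[of n] by simp
    moreover have "ln (Zsum n u * (exp (- c * real n) / 4)) = ln (Zsum n u) - c * real n - ln 4"
      using Z[of n] by (simp add: ln_mult ln_div)
    ultimately show ?thesis using 1 by (simp add: abs_le_iff)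
  qed
  have bound: "\<bar>ln (S n) / real n - (pr u - c)\<bar> \<le> (2 * ln 4) / real n" if n: "n \<ge> 1" for n
  proof -
    have "ln (S n) / real n - (ln (Zsum n u) / real n - c) = (ln (S n) - (ln (Zsum n u) - c * real n)) / real n"
      using n by (simp add: field_simps)
    then have 1: "\<bar>ln (S n) / real n - (ln (Zsum n u) / real n - c)\<bar> \<le> ln 4 / real n"
      using divide_right_mono[OF lnS[of n], of "real n"] by (simp add: abs_divide)
    have 2: "\<bar>ln (Zsum n u) / real n - pr u\<bar> \<le> ln 4 / real n" using u n by (intro pr_approx) auto
    have "\<bar>x - (z - c)\<bar> \<le> e \<Longrightarrow> \<bar>z - p\<bar> \<le> e \<Longrightarrow> \<bar>x - (p - c)\<bar> \<le> 2 * e" for x z p e :: real by linarith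
    from this[OF 1 2] show ?thesis by simp
  qed
  have "(\<lambda>n. ln (S n) / real n - (pr u - c)) \<longlonglongrightarrow> 0"
  proof (rule Lim_null_comparison)
    show "(\<lambda>n. (2 * ln 4) / real n) \<longlonglongrightarrow> 0" by (rule lim_const_over_n)
    show "\<forall>\<^sub>F n in sequentially. norm (ln (S n) / real n - (pr u - c)) \<le> 2 * ln 4 / real n"
      using eventually_ge_at_top[of 1] by eventually_elim (use bound in auto)
  qed
  then have "(\<lambda>n. ln (S n) / real n) \<longlonglongrightarrow> pr u - c" by (rule LIM_zero_cancel)
  then have "(\<lambda>n. ereal (ln (S n) / real n)) \<longlonglongrightarrow> ereal (pr u - c)" by (rule tendsto_ereal)
  moreover have "\<forall>\<^sub>F n in sequentially. ereal (ln (S n) / real n) = ln_ennreal (partition_sum \<phi> y n) / ereal (real n)"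
    using eventually_ge_at_top[of 1]
  proof eventually_elim
    case (elim n)
    have "ln_ennreal (ennreal (S n)) = ereal (ln (S n))"
      using Spos[of n] by (simp add: ln_ennreal_def)
    then show ?case using elim by (simp add: ps)
  qed
  ultimately show "(\<lambda>n. ln_ennreal (partition_sum (\<lambda>x. - u * ln \<bar>deriv gauss_map x\<bar> - c) y n) / ereal (real n))
      \<longlonglongrightarrow> ereal (pr u - c)"
    unfolding \<phi>_def by (rule Lim_transform_eventually)
qed

text \<open>The strict inequality \<open>pr t > l\<close> beats any constant factor once the blocks
  are long enough; 32 is what \<open>adm_deep\<close> asks for. Truncating the convergent series
  makes \<open>W\<close> finite.\<close>

lemma finite_block_exists:
  assumes t: "1/2 < t" "t \<le> 1" and P: "pr t > l" 
  shows "\<exists>n W. finite W \<and> W \<subseteq> words n \<and> sum (wt t) W > 32 * exp (l * real n)"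
proof -
  obtain n where n: "(ln 4 + ln 32) / (pr t - l) < real n" using reals_Archimedean2 by blast
  have "0 \<le> (ln 4 + ln 32) / (pr t - l)" using P by (intro divide_nonneg_pos) auto
  then have n1: "n \<ge> 1" using n by (cases n) auto
  have "ln 4 + ln 32 < real n * (pr t - l)" using n P by (simp add: pos_divide_less_eq)
  moreover have "real n * pr t \<le> ln (Zsum n t) + ln 4"
    using pr_approx[OF t n1] n1 by (simp add: abs_le_iff field_simps)
  ultimately have "ln 32 + l * real n < ln (Zsum n t)" by (simp add: algebra_simps)
  then have "exp (ln 32 + l * real n) < Zsum n t" 
  proof -
    assume "ln 32 + l * real n < ln (Zsum n t)"
    then have "exp (ln 32 + l * real n) < exp (ln (Zsum n t))" by simp
    then show ?thesis using Zsum_pos[OF t(1), of n] by (simp only: exp_ln)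
  qed
  then have lt: "32 * exp (l * real n) < Zsum n t" by (simp add: exp_add)
  have "\<exists>W. finite W \<and> W \<subseteq> words n \<and> sum (wt t) W > 32 * exp (l * real n)"
  proof (rule ccontr)
    assume "\<not> ?thesis"
    then have "Zsum n t \<le> 32 * exp (l * real n)" by (intro Zsum_le t) (auto simp: not_less)
    then show False using lt by simp
  qed
  then show ?thesis by blast
qed

section \<open>Refining densities along the limsup set\<close>

lemma small_cylinder_eventually:
  assumes "x \<in> {0<..<1} - \<rat>" "open V" "x \<in> V"
  shows "\<forall>\<^sub>F n in sequentially. cyl (digits n x) \<subseteq> V"
proof -
  obtain e where e: "e > 0" "ball x e \<subseteq> V" using assms(2,3) openE by blast
  obtain k where k: "(1/4) ^ k < e" using real_arch_pow_inv[OF e(1), of "1/4"] by auto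
  have "cyl (digits n x) \<subseteq> V" if n: "n \<ge> 2 * k" for n
  proof (rule cyl_eq_interval[OF digits_props(2)[OF assms(1), of n]])
    fix l h assume lh: "cyl (digits n x) = {l<..<h}" "h - l = len (digits n x)"
    have "len (digits n x) \<le> (1/4) ^ (n div 2)"
      using len_le_growth[OF digits_props(2)[OF assms(1), of n]] digits_props(1)[OF assms(1)] by simp
    also have "\<dots> \<le> (1/4) ^ k" using n by (intro power_decreasing) auto
    finally have "h - l < e" using k lh by linarith
    moreover have "x \<in> {l<..<h}" using in_cyl_digits[OF assms(1)] lh by blast
    ultimately have "{l<..<h} \<subseteq> ball x e" by (auto simp: dist_real_def)
    then show ?thesis using e lh by blast
  qed
  then show ?thesis unfolding eventually_sequentially by blast
qed

lemma bdens_supp_01: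
  assumes "bdens M f" "f x \<noteq> 0" "x \<notin> \<rat>"
  shows "x \<in> {0<..<1} - \<rat>"
proof -
  have "x \<in> {0..1}"
  proof (rule ccontr)
    assume "x \<notin> {0..1}"
    then have "f x \<le> 0" "0 \<le> f x" using assms(1) unfolding bdens_def by (metis indicator_simps(2) mult_zero_right)+
    then show False using assms(2) by simp
  qed
  moreover have "x \<noteq> 0" "x \<noteq> 1" using assms(3) by auto
  ultimately show ?thesis using assms(3) by auto
qed

text \<open>Two losses of \<open>\<epsilon> / 2\<close>: a level deep enough that the cylinders
  inside \<open>V\<close> catch almost all mass, then a bound on the digits, which leaves finitely
  many of them. Having one common level, they are disjoint.\<close>

lemma finitely_many_cylinders:
  assumes f: "bdens M f" "\<And>x. f x \<noteq> 0 \<Longrightarrow> x \<in> V" and V: "open V" and e: "\<epsilon> > 0" "\<delta> > 0"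
  shows "\<exists>n\<ge>n0. \<exists>W. finite W \<and> W \<subseteq> words n \<and> (\<forall>w\<in>W. cyl w \<subseteq> V \<and> len w \<le> \<delta>) \<and>
     mass f UNIV - \<epsilon> \<le> mass f (\<Union>w\<in>W. cyl w)"
proof -
  have op: "(\<Union>w\<in>A. cyl w) \<in> sets borel" if "A \<subseteq> words n" for A n
    using that by (intro borel_open open_UN ballI open_cyl) (auto simp: words_iff)
  define S where "S n = (\<Union>w\<in>{w\<in>words n. cyl w \<subseteq> V}. cyl w)" for n
  have Sb: "S n \<in> sets borel" for n unfolding S_def by (rule op[of _ n]) auto
  have "(\<lambda>n. mass f (S n)) \<longlonglongrightarrow> mass f UNIV"
  proof (rule mass_LIMSEQ[OF f(1) Sb countable_rat])
    fix x assume x: "f x \<noteq> 0" "x \<notin> \<rat>"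
    note x01 = bdens_supp_01[OF f(1) x]
    show "\<forall>\<^sub>F n in sequentially. x \<in> S n"
      using small_cylinder_eventually[OF x01 V f(2)[OF x(1)]]
    proof eventually_elim
      case (elim n)
      then show ?case
        unfolding S_def using in_cyl_digits[OF x01, of n] digits_props(1,2)[OF x01, of n]
        by (intro UN_I[of "digits n x"]) (auto simp: words_iff)
    qed
  qed
  then have ev1: "\<forall>\<^sub>F n in sequentially. mass f UNIV - \<epsilon> / 2 < mass f (S n)"
    using e by (intro order_tendstoD(1)) auto
  obtain k where k: "(1/4) ^ k < \<delta>" using real_arch_pow_inv[OF e(2), of "1/4"] by auto
  obtain N where N: "\<And>n. n \<ge> N \<Longrightarrow> mass f UNIV - \<epsilon> / 2 < mass f (S n)"
    using ev1 unfolding eventually_sequentially by blast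
  define n where "n = max N (max n0 (2 * k))"
  have n: "n \<ge> N" "n \<ge> n0" "n \<ge> 2 * k" by (auto simp: n_def)
  have small: "len w \<le> \<delta>" if "w \<in> words n" for w
  proof -
    have "len w \<le> (1/4) ^ (n div 2)" using len_le_growth[of w] that by (simp add: words_iff)
    also have "\<dots> \<le> (1/4) ^ k" using n(3) by (intro power_decreasing) auto
    finally show ?thesis using k by linarith
  qed
  define W where "W j = {w\<in>words n. cyl w \<subseteq> V \<and> set w \<subseteq> {..j}}" for j
  have Wn: "W j \<subseteq> words n" for j by (auto simp: W_def)
  define g where "g = (\<lambda>x. f x * indicator (S n) x :: real)"
  have g: "bdens M g" unfolding g_def by (rule bdens_restrict[OF f(1) Sb])
  have gm: "mass g A = mass f (S n \<inter> A)" for A unfolding g_def by (rule mass_restrict)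
  have "(\<lambda>j. mass g (\<Union>w\<in>W j. cyl w)) \<longlonglongrightarrow> mass g UNIV"
  proof (rule mass_LIMSEQ[OF g op[OF Wn] countable_empty])
    fix x assume "g x \<noteq> 0"
    then have "x \<in> S n" by (auto simp: g_def indicator_def split: if_splits)
    then obtain w where w: "w \<in> words n" "cyl w \<subseteq> V" "x \<in> cyl w" by (auto simp: S_def)
    have "x \<in> (\<Union>w\<in>W j. cyl w)" if "j \<ge> Max (set w \<union> {0})" for j
    proof -
      have "set w \<subseteq> {..j}" using that by auto
      then show ?thesis using w by (auto simp: W_def)
    qed
    then show "\<forall>\<^sub>F j in sequentially. x \<in> (\<Union>w\<in>W j. cyl w)"
      unfolding eventually_sequentially by blast
  qed
  moreover have "mass g UNIV - \<epsilon> / 2 < mass g UNIV" using e by simp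
  ultimately have "\<forall>\<^sub>F j in sequentially. mass g UNIV - \<epsilon> / 2 < mass g (\<Union>w\<in>W j. cyl w)"
    by (rule order_tendstoD(1))
  then obtain j where j: "mass g UNIV - \<epsilon> / 2 < mass g (\<Union>w\<in>W j. cyl w)"
    using eventually_happens' sequentially_bot by blast
  have "mass g (\<Union>w\<in>W j. cyl w) \<le> mass f (\<Union>w\<in>W j. cyl w)"
    unfolding gm by (intro mass_mono[OF f(1)] sets.Int Sb op[OF Wn]) auto
  then have "mass f UNIV - \<epsilon> \<le> mass f (\<Union>w\<in>W j. cyl w)"
    using j N[OF n(1)] unfolding gm by simp
  moreover have "finite (W j)"
    by (rule finite_subset[OF _ finite_lists_length_eq[of "{..j}" n]]) (auto simp: W_def words_def)
  ultimately show ?thesis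
    using n(2) Wn[of j] small by (intro exI[of _ n] conjI exI[of _ "W j"]) (auto simp: W_def)
qed

text \<open>Little mass lies near the complement of \<open>U\<close> or near \<open>q\<close>. The
  closure is taken inside \<open>U\<close> to obtain nested compact sets; removing one rational
  \<open>q\<close> at each stage keeps all rationals out of their intersection.\<close>

lemma mass_trim:
  assumes g: "bdens M g" "\<And>x. g x \<noteq> 0 \<Longrightarrow> x \<in> U" and U: "open U" and e: "\<epsilon> > 0"
  shows "\<exists>V. open V \<and> closure V \<subseteq> U - {q} \<and> mass g UNIV - \<epsilon> \<le> mass g V"
proof -
  \<comment> \<open>Containing \<open>q\<close>, this set is nonempty, so \<open>infdist\<close> to
    it is not the default 0 for the empty set.\<close>
  define C where "C = - (U - {q})"
  have C: "closed C" "C \<noteq> {}" unfolding C_def by (rule closed_Compl[OF open_delete[OF U]]) auto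
  define V where "V j = {x. 1 / real (Suc j) < infdist x C}" for j
  have op: "open (V j)" for j
    unfolding V_def by (intro open_Collect_less continuous_intros)
  have cl: "closure (V j) \<subseteq> U - {q}" for j
  proof -
    have "closure (V j) \<subseteq> {x. 1 / real (Suc j) \<le> infdist x C}"
    proof (rule closure_minimal)
      show "closed {x. 1 / real (Suc j) \<le> infdist x C}"
        by (intro closed_Collect_le continuous_intros)
    qed (auto simp: V_def)
    also have "\<dots> \<subseteq> U - {q}"
    proof
      fix x assume "x \<in> {x. 1 / real (Suc j) \<le> infdist x C}"
      moreover have "0 < 1 / real (Suc j)" by simp
      ultimately have "infdist x C \<noteq> 0" by (metis mem_Collect_eq not_le)
      then have "x \<notin> C" by (metis infdist_zero)
      then show "x \<in> U - {q}" by (simp add: C_def)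
    qed
    finally show ?thesis .
  qed
  have "(\<lambda>j. mass g (V j)) \<longlonglongrightarrow> mass g UNIV"
  proof (rule mass_LIMSEQ[OF g(1) borel_open[OF op] countable_finite[of "{q}"]])
    fix x assume "g x \<noteq> 0" "x \<notin> {q}"
    then have "x \<notin> C" using g(2) by (auto simp: C_def)
    then have "0 < infdist x C" using C by (intro infdist_pos_not_in_closed)
    moreover have "(\<lambda>j. 1 / real (Suc j)) \<longlonglongrightarrow> 0" by (rule LIMSEQ_Suc[OF lim_1_over_n])
    ultimately have "\<forall>\<^sub>F j in sequentially. 1 / real (Suc j) < infdist x C" by (intro order_tendstoD(2))
    then show "\<forall>\<^sub>F j in sequentially. x \<in> V j" by (simp add: V_def)
  qed simp
  moreover have "mass g UNIV - \<epsilon> < mass g UNIV" using e by simp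
  ultimately have "\<forall>\<^sub>F j in sequentially. mass g UNIV - \<epsilon> < mass g (V j)" by (rule order_tendstoD(1))
  then obtain j where "mass g UNIV - \<epsilon> < mass g (V j)"
    using eventually_happens' sequentially_bot by blast
  then show ?thesis using op cl by (intro exI[of _ "V j"]) auto
qed

definition admissible_density :: "real \<Rightarrow> real \<Rightarrow> (real \<Rightarrow> real) \<Rightarrow> real set \<Rightarrow> bool" where
  "admissible_density t C f V \<longleftrightarrow> (\<exists>M. bdens M f) \<and> open V \<and> (\<forall>x. f x \<noteq> 0 \<longrightarrow> x \<in> V) \<and>
     (\<forall>a b. a \<le> b \<longrightarrow> mass f {a..b} \<le> C * (b - a) powr t)"

text \<open>On a cylinder of length \<open>l\<close> the mass is at most \<open>M * l\<close>; replacing it by a copy with local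
  constant \<open>K\<close> gives subintervals of length \<open>r\<close> at most \<open>M * K * l powr (1 - t) * r powr t\<close>, which is
  negligible for small \<open>l\<close> because \<open>t < 1\<close>.\<close>

lemma refine_density:
  assumes t: "0 < t" "t < 1" and K: "K \<ge> 1" and T: "open T" 
    and adm: "\<And>u. pos_word u \<Longrightarrow> length u \<ge> n0 \<Longrightarrow> adm T t K u"
    and f: "admissible_density t C f V" and e: "\<epsilon> > 0"
  shows "\<exists>g V'. admissible_density t (C + \<epsilon>) g V' \<and> closure V' \<subseteq> V \<inter> T - {q} \<and> mass f UNIV - \<epsilon> \<le> mass g UNIV"
proof -
  obtain M where M: "bdens M f" using f by (auto simp: admissible_density_def)
  have V: "open V" and fV: "\<And>x. f x \<noteq> 0 \<Longrightarrow> x \<in> V"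
    and fr: "\<And>a b. a \<le> b \<Longrightarrow> mass f {a..b} \<le> C * (b - a) powr t"
    using f by (auto simp: admissible_density_def)
  have M0: "M \<ge> 0" by (rule bdensD(4)[OF M])
  \<comment> \<open>By \<open>mass_mixture\<close> the two cut cylinders add at most
    \<open>2 * M * K * \<eta>\<close> to the Frostman constant; the 1 keeps the denominator positive
    when \<open>M = 0\<close>.\<close>
  define \<eta> where "\<eta> = \<epsilon> / (2 * M * K + 1)"
  have den0: "2 * M * K + 1 > 0" 
  proof -
    have "0 \<le> M * K" using M0 K by simp
    then show ?thesis by linarith
  qed
  have eta: "\<eta> > 0" using e den0 by (simp add: \<eta>_def)
  have eta2: "2 * (M * K * \<eta>) \<le> \<epsilon>"
  proof -
    have "\<eta> * (2 * M * K + 1) = \<epsilon>" using den0 by (simp add: \<eta>_def)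
    then show ?thesis using eta by (simp add: algebra_simps)
  qed
  \<comment> \<open>The length \<open>l\<close> at which \<open>l powr (1 - t)\<close> equals
    \<open>\<eta>\<close>.\<close>
  define \<delta> where "\<delta> = \<eta> powr (1 / (1 - t))"
  have delta: "\<delta> > 0" "\<delta> powr (1 - t) = \<eta>" using eta t by (auto simp: \<delta>_def powr_powr)
  have e2: "\<epsilon> / 2 > 0" using e by simp
  obtain n W where n: "n \<ge> n0" and W: "finite W" "W \<subseteq> words n" "\<And>w. w \<in> W \<Longrightarrow> cyl w \<subseteq> V"
    "\<And>w. w \<in> W \<Longrightarrow> len w \<le> \<delta>" "mass f UNIV - \<epsilon> / 2 \<le> mass f (\<Union>w\<in>W. cyl w)"
    using finitely_many_cylinders[OF M fV V e2 delta(1), of n0] by blast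
  have pw: "pos_word w" "length w = n" if "w \<in> W" for w using that W(2) by (auto simp: words_iff)
  have "\<forall>w\<in>W. \<exists>gM. bdens (snd gM) (fst gM) \<and> (\<forall>x. fst gM x \<noteq> 0 \<longrightarrow> x \<in> cyl w \<inter> T) \<and>
     mass (fst gM) UNIV = 1 \<and> (\<forall>a b. a \<le> b \<longrightarrow> mass (fst gM) {a..b} \<le> K * ((b - a) / len w) powr t)"
    using adm[OF pw(1)] pw(2) n unfolding adm_def by auto
  then obtain gM where gM: "\<forall>w\<in>W. bdens (snd (gM w)) (fst (gM w)) \<and>
     (\<forall>x. fst (gM w) x \<noteq> 0 \<longrightarrow> x \<in> cyl w \<inter> T) \<and>
     mass (fst (gM w)) UNIV = 1 \<and> (\<forall>a b. a \<le> b \<longrightarrow> mass (fst (gM w)) {a..b} \<le> K * ((b - a) / len w) powr t)"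
    by (rule bchoice[THEN exE])
  define g where "g w = fst (gM w)" for w
  define N where "N w = snd (gM w)" for w
  have g1: "bdens (N w) (g w)" if "w \<in> W" for w using gM that by (simp add: g_def N_def)
  have g2: "x \<in> cyl w" "x \<in> T" if "w \<in> W" "g w x \<noteq> 0" for w x
    using gM that by (auto simp: g_def)
  have g3: "mass (g w) UNIV = 1" if "w \<in> W" for w using gM that by (simp add: g_def)
  have g4: "mass (g w) {a..b} \<le> K * ((b - a) / len w) powr t" if "w \<in> W" "a \<le> b" for w a b
    using gM that by (simp add: g_def)
  define c where "c w = mass f (cyl w)" for w
  have c0: "c w \<ge> 0" for w unfolding c_def by (rule mass_nonneg[OF M])
  have cyl_borel: "cyl w \<in> sets borel" if "w \<in> W" for w using pw[OF that] by (intro borel_open open_cyl)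
  have disj: "disjoint_family_on cyl W" by (rule disjoint_family_cyl[OF pw])
  define G where "G = (\<lambda>x. \<Sum>w\<in>W. c w * g w x)"
  have bG: "bdens (\<Sum>w\<in>W. c w * N w) G" unfolding G_def by (rule bdens_sum[OF W(1) g1 c0])
  have mG: "mass G S = (\<Sum>w\<in>W. c w * mass (g w) S)" if "S \<in> sets borel" for S
    unfolding G_def by (rule mass_sum[OF g1 that])
  have Gsupp: "x \<in> V \<inter> T" if "G x \<noteq> 0" for x
  proof -
    have "\<exists>w\<in>W. g w x \<noteq> 0"
    proof (rule ccontr)
      assume "\<not> (\<exists>w\<in>W. g w x \<noteq> 0)"
      then have "G x = 0" unfolding G_def by (intro sum.neutral) auto
      with that show False by simp
    qed
    then show ?thesis using g2 W(3) by blast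
  qed
  have "mass G UNIV = (\<Sum>w\<in>W. c w)" using mG[of UNIV] g3 by simp
  also have "\<dots> = mass f (\<Union>w\<in>W. cyl w)"
    unfolding c_def by (rule mass_disjoint_UN[OF M W(1) cyl_borel disj])
  finally have Gtotal: "mass f UNIV - \<epsilon> / 2 \<le> mass G UNIV" using W(5) by simp
  have Gfr: "mass G {a..b} \<le> (C + \<epsilon>) * (b - a) powr t" if ab: "a \<le> b" for a b
  proof -
    define y where "y = (b - a) powr t"
    have y: "y \<ge> 0" by (simp add: y_def)
    have "mass G {a..b} \<le> (\<Sum>w\<in>{w\<in>W. cyl w \<subseteq> {a..b}}. c w) + 2 * (M * K * \<eta> * y)"
      unfolding mG[OF borel_closed[OF closed_atLeastAtMost]]
    proof (rule mass_mixture[OF W(1) disj is_interval_cyl[OF pw(1)] g1 g2(1)])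
      show "mass (g w) UNIV \<le> 1" if "w \<in> W" for w using g3[OF that] by simp
      show "0 \<le> M * K * \<eta> * y" using M0 K eta y by simp
      show "c w * mass (g w) {a..b} \<le> M * K * \<eta> * y" if w: "w \<in> W" for w
      proof -
        have L: "len w > 0" using len_pos[OF pw(1)[OF w]] .
        have "c w \<le> M * len w"
        proof (rule cyl_eq_interval[OF pw(1)[OF w]])
          fix l h assume lh: "l < h" "cyl w = {l<..<h}" "h - l = len w"
          have "c w \<le> mass f {l..h}"
            unfolding c_def lh(2) by (rule mass_mono[OF M]) auto
          also have "\<dots> \<le> M * (h - l)" by (rule mass_le_Lebesgue[OF M]) (use lh in simp)
          finally show ?thesis using lh by simp
        qed
        then have "c w * mass (g w) {a..b} \<le> M * len w * (K * ((b - a) / len w) powr t)"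
          using g4[OF w ab] mass_nonneg[OF g1[OF w]] M0 L by (intro mult_mono) auto
        also have "((b - a) / len w) powr t = y / len w powr t" using ab L by (simp add: y_def powr_divide)
        also have "M * len w * (K * (y / len w powr t)) = M * K * len w powr (1 - t) * y"
          using L by (simp add: powr_diff)
        also have "\<dots> \<le> M * K * \<eta> * y"
        proof (intro mult_right_mono mult_left_mono)
          show "len w powr (1 - t) \<le> \<eta>"
            unfolding delta(2)[symmetric] using L W(4)[OF w] t by (intro powr_mono2) auto
        qed (use M0 K y in auto)
        finally show ?thesis .
      qed
    qed (use c0 in auto)
    also have "(\<Sum>w\<in>{w\<in>W. cyl w \<subseteq> {a..b}}. c w) = mass f (\<Union>w\<in>{w\<in>W. cyl w \<subseteq> {a..b}}. cyl w)"
      unfolding c_def using W(1) disj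
      by (intro mass_disjoint_UN[OF M] cyl_borel) (auto simp: disjoint_family_on_def)
    also have "\<dots> \<le> mass f {a..b}"
    proof (rule mass_mono[OF M])
      show "(\<Union>w\<in>{w\<in>W. cyl w \<subseteq> {a..b}}. cyl w) \<in> sets borel"
        using pw(1) by (intro borel_open open_UN ballI open_cyl) auto
    qed auto
    also have "\<dots> \<le> C * y" unfolding y_def by (rule fr[OF ab])
    also have "2 * (M * K * \<eta> * y) \<le> \<epsilon> * y"
      using mult_right_mono[OF eta2 y] by (simp add: mult.assoc)
    finally show ?thesis by (simp add: y_def algebra_simps)
  qed
  obtain V' where V': "open V'" "closure V' \<subseteq> V \<inter> T - {q}" "mass G UNIV - \<epsilon> / 2 \<le> mass G V'"
    using mass_trim[OF bG Gsupp open_Int[OF V T] e2, of q] by blast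
  define G' where "G' = (\<lambda>x. G x * indicator V' x :: real)"
  have G': "bdens (\<Sum>w\<in>W. c w * N w) G'"
    unfolding G'_def by (rule bdens_restrict[OF bG borel_open[OF V'(1)]])
  have mG': "mass G' S = mass G (V' \<inter> S)" for S unfolding G'_def by (rule mass_restrict)
  have "mass G' {a..b} \<le> (C + \<epsilon>) * (b - a) powr t" if "a \<le> b" for a b
  proof -
    have "mass G' {a..b} \<le> mass G {a..b}"
      unfolding mG' by (intro mass_mono[OF bG] sets.Int borel_open[OF V'(1)]) auto
    then show ?thesis using Gfr[OF that] by simp
  qed
  moreover have "x \<in> V'" if "G' x \<noteq> 0" for x
    using that by (auto simp: G'_def indicator_def split: if_splits)
  ultimately have "admissible_density t (C + \<epsilon>) G' V'"
    unfolding admissible_density_def using G' V'(1) by blast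
  moreover have "mass f UNIV - \<epsilon> \<le> mass G' UNIV" using V'(3) Gtotal unfolding mG' by simp
  ultimately show ?thesis using V'(2) by blast
qed

lemma density_sequence:
  fixes T :: "nat \<Rightarrow> real set" and q :: "nat \<Rightarrow> real"
  assumes t: "0 < t" "t < 1" and K: "K \<ge> 1" and T: "\<And>n. open (T n)"
    and adm: "\<And>n u. pos_word u \<Longrightarrow> length u \<ge> n \<Longrightarrow> adm (T n) t K u"
    and xr: "r > 0" "ball x r \<subseteq> {0..1}"
  shows "\<exists>f V. V 0 = ball x r \<and> (\<forall>k. admissible_density t (2 * (2 * r) powr - t) (f k) (V k) \<and>
     1/2 \<le> mass (f k) UNIV \<and> closure (V (Suc k)) \<subseteq> V k \<inter> T k - {q k})"
proof -
  define D where "D = (2 * r) powr - t"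
  have D: "D > 0" using xr by (simp add: D_def)
  \<comment> \<open>Two geometric budgets: the Frostman constant rises from \<open>D\<close> but
    stays below \<open>2 * D\<close>, and the guaranteed mass falls from 1 but stays above
    1/2.\<close>
  define P where "P k s \<longleftrightarrow> admissible_density t (D * (2 - (1/2) ^ k)) (fst s) (snd s) \<and>
    1/2 + (1/2) ^ k / 2 \<le> mass (fst s) UNIV \<and> (k = 0 \<longrightarrow> snd s = ball x r)"
    for k and s :: "(real \<Rightarrow> real) \<times> real set"
  define Q where "Q k s s' \<longleftrightarrow> closure (snd s') \<subseteq> snd s \<inter> T k - {q k}"
    for k and s s' :: "(real \<Rightarrow> real) \<times> real set"
  have "\<exists>s. \<forall>k. P k (s k) \<and> Q k (s k) (s (Suc k))"
  proof (rule dependent_nat_choice)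
    have b: "ball x r = {x - r<..<x + r}" by (auto simp: dist_real_def)
    have cl: "{x - r..x + r} \<subseteq> {0..1}"
      using closure_mono[OF xr(2)] xr(1) by (simp add: cball_eq_atLeastAtMost)
    then have lh: "0 \<le> x - r" "x - r < x + r" "x + r \<le> 1" using xr(1) by auto
    define f where "f = (\<lambda>y. 1 / (x + r - (x - r)) * indicator {x - r<..<x + r} y :: real)"
    note U = uniform_density[OF lh t(1) less_imp_le[OF t(2)], folded f_def]
    have "admissible_density t D f (ball x r)"
      unfolding admissible_density_def
    proof (intro conjI allI impI)
      show "\<exists>M. bdens M f" using U(1) by blast
      show "y \<in> ball x r" if "f y \<noteq> 0" for y
        using that unfolding b by (auto simp: f_def indicator_def split: if_splits)
      show "mass f {a..b} \<le> D * (b - a) powr t" if "a \<le> b" for a b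
        using U(3)[OF that] that xr(1) by (simp add: D_def powr_divide powr_minus_divide)
    qed simp
    then show "\<exists>s. P 0 s" using U(2) by (intro exI[of _ "(f, ball x r)"]) (simp add: P_def)
  next
    fix s k assume s: "P k s"
    \<comment> \<open>Small enough for both budgets: stage \<open>k\<close> may add
      \<open>D * (1/2) ^ Suc k\<close> to the constant and lose \<open>(1/2) ^ Suc k / 2\<close> of
      the mass.\<close>
    define \<epsilon> where "\<epsilon> = min D (1/2) * (1/2) ^ Suc k"
    have e: "\<epsilon> > 0" "\<epsilon> \<le> D * (1/2) ^ Suc k" "\<epsilon> \<le> (1/2) ^ Suc k / 2"
    proof -
      show "\<epsilon> > 0" using D by (simp add: \<epsilon>_def)
      have "min D (1/2) * (1/2) ^ Suc k \<le> D * (1/2) ^ Suc k" by (intro mult_right_mono) auto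
      then show "\<epsilon> \<le> D * (1/2) ^ Suc k" by (simp only: \<epsilon>_def)
      have "min D (1/2) * (1/2) ^ Suc k \<le> (1/2) * (1/2) ^ Suc k" by (intro mult_right_mono) auto
      then show "\<epsilon> \<le> (1/2) ^ Suc k / 2" by (simp add: \<epsilon>_def)
    qed
    have fs: "admissible_density t (D * (2 - (1/2) ^ k)) (fst s) (snd s)" using s by (simp add: P_def)
    obtain g V' where g: "admissible_density t (D * (2 - (1/2) ^ k) + \<epsilon>) g V'"
      "closure V' \<subseteq> snd s \<inter> T k - {q k}" "mass (fst s) UNIV - \<epsilon> \<le> mass g UNIV"
      using refine_density[OF t K T adm fs e(1), where q = "q k"] by blast
    have "D * (2 - (1/2) ^ k) + \<epsilon> \<le> D * (2 - (1/2) ^ Suc k)"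
      using e(2) by (simp add: algebra_simps)
    then have "(D * (2 - (1/2) ^ k) + \<epsilon>) * z \<le> D * (2 - (1/2) ^ Suc k) * z" if "z \<ge> 0" for z
      using that by (intro mult_right_mono)
    then have "admissible_density t (D * (2 - (1/2) ^ Suc k)) g V'"
      using g(1) unfolding admissible_density_def by (meson order.trans powr_ge_zero)
    moreover have "1/2 + (1/2) ^ Suc k / 2 \<le> mass g UNIV"
      using s g(3) e(3) by (simp add: P_def)
    ultimately show "\<exists>s'. P (Suc k) s' \<and> Q k s s'"
      using g(2) by (intro exI[of _ "(g, V')"]) (simp add: P_def Q_def)
  qed
  then obtain s where s: "\<And>k. P k (s k)" "\<And>k. Q k (s k) (s (Suc k))" by blast
  have "admissible_density t (2 * (2 * r) powr - t) (fst (s k)) (snd (s k))" for k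
  proof -
    have "D * (2 - (1/2) ^ k) * z \<le> 2 * D * z" if "z \<ge> 0" for z
      using that D by (intro mult_right_mono) auto
    moreover have "admissible_density t (D * (2 - (1/2) ^ k)) (fst (s k)) (snd (s k))" using s(1)[of k] by (simp add: P_def)
    ultimately show ?thesis
      unfolding admissible_density_def D_def by (meson order.trans powr_ge_zero)
  qed
  moreover have "1/2 \<le> mass (fst (s k)) UNIV" for k
  proof -
    have "0 \<le> (1/2::real) ^ k / 2" by simp
    then show ?thesis using s(1)[of k] unfolding P_def by linarith
  qed
  moreover have "snd (s 0) = ball x r" using s(1)[of 0] by (simp add: P_def)
  moreover have "closure (snd (s (Suc k))) \<subseteq> snd (s k) \<inter> T k - {q k}" for k using s(2)[of k] by (simp add: Q_def)
  ultimately show ?thesis by (intro exI[of _ "\<lambda>k. fst (s k)"] exI[of _ "\<lambda>k. snd (s k)"]) blast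
qed

section \<open>Hausdorff content of the limsup set\<close>

lemma hausdorff_content_ball_le:
  assumes "t > 0" "r > 0"
  shows "hausdorff_content t (ball x r) \<le> ennreal ((2 * r) powr t)"
proof -
  \<comment> \<open>The cover is padded with balls of radius 0: they are empty, have diameter 0, and
    \<open>0 powr t = 0\<close>.\<close>
  define U where "U i = (if i = 0 then ball x r else ball x 0)" for i :: nat
  have "(\<Sum>i. ennreal (diameter (U i) powr t)) = (\<Sum>i\<in>{0}. ennreal (diameter (U i) powr t))"
    by (rule suminf_finite) (auto simp: U_def)
  also have "\<dots> = ennreal ((2 * r) powr t)" using assms by (simp add: U_def)
  finally have "ennreal ((2 * r) powr t) = (\<Sum>i. ennreal (diameter (U i) powr t))" by simp
  moreover have "\<exists>c \<rho>. U i = ball c \<rho>" for i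
    unfolding U_def by (rule exI[of _ x], rule exI[of _ "if i = 0 then r else 0"]) simp
  moreover have "ball x r \<subseteq> (\<Union>i. U i)" by (auto simp: U_def)
  ultimately show ?thesis unfolding hausdorff_content_def by (intro Inf_lower) blast
qed

text \<open>Allows the cover to be tested on finitely many of its members, which is all that
  compactness provides.\<close>

lemma hausdorff_content_ge:
  assumes "\<And>U :: nat \<Rightarrow> real set. (\<And>i. \<exists>c r. U i = ball c r) \<Longrightarrow> A \<subseteq> (\<Union>i. U i) \<Longrightarrow>
    \<exists>J. finite J \<and> z \<le> (\<Sum>i\<in>J. diameter (U i) powr t)"
  shows "ennreal z \<le> hausdorff_content t A"
  unfolding hausdorff_content_def
proof (rule Inf_greatest)
  fix S assume "S \<in> {(\<Sum>i. ennreal (diameter (U i) powr t)) | U :: nat \<Rightarrow> real set.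
            (\<forall>i. \<exists>c r. U i = ball c r) \<and> A \<subseteq> (\<Union>i. U i)}"
  then obtain U :: "nat \<Rightarrow> real set" where U: "S = (\<Sum>i. ennreal (diameter (U i) powr t))"
    "\<And>i. \<exists>c r. U i = ball c r" "A \<subseteq> (\<Union>i. U i)" by blast
  obtain J where J: "finite J" "z \<le> (\<Sum>i\<in>J. diameter (U i) powr t)" using assms[OF U(2,3)] by blast
  have "ennreal z \<le> ennreal (\<Sum>i\<in>J. diameter (U i) powr t)" by (rule ennreal_leI[OF J(2)])
  also have "\<dots> = (\<Sum>i\<in>J. ennreal (diameter (U i) powr t))" by (rule sum_ennreal[symmetric]) simp
  also have "\<dots> \<le> S" unfolding U(1) using J(1) by (intro sum_le_suminf) auto
  finally show "ennreal z \<le> S" .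
qed

text \<open>No limit measure is needed: compactness reduces any cover to finitely many balls that
  already contain the support of a late density. Its mass is at least 1/2 and its Frostman constant
  is \<open>2 * (2 * r) powr - t\<close>, which yields the 1/4. \<open>K\<close> does not appear in
  the bound.\<close>

lemma content_limsup_set:
  fixes T :: "nat \<Rightarrow> real set"
  assumes t: "0 < t" "t < 1" and K: "K \<ge> 1" and T: "\<And>n. open (T n)"
    and adm: "\<And>n u. pos_word u \<Longrightarrow> length u \<ge> n \<Longrightarrow> adm (T n) t K u"
    and A: "{x \<in> {0<..<1} - \<rat>. \<forall>n. x \<in> T n} \<subseteq> A"
    and xr: "r > 0" "ball x r \<subseteq> {0..1}"
  shows "ennreal ((2 * r) powr t / 4) \<le> hausdorff_content t (A \<inter> ball x r)"
proof (rule hausdorff_content_ge)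
  fix U :: "nat \<Rightarrow> real set"
  assume U: "\<And>i. \<exists>c r. U i = ball c r" and cover: "A \<inter> ball x r \<subseteq> (\<Union>i. U i)"
  define q where "q = from_nat_into (\<rat> :: real set)"
  have q: "range q = \<rat>" unfolding q_def by (rule range_from_nat_into[OF _ countable_rat]) auto
  define D where "D = 2 * (2 * r) powr - t"
  have D: "D > 0" using xr by (simp add: D_def)
  have "\<exists>f V. V 0 = ball x r \<and> (\<forall>k. admissible_density t D (f k) (V k) \<and>
     1/2 \<le> mass (f k) UNIV \<and> closure (V (Suc k)) \<subseteq> V k \<inter> T k - {q k})"
    unfolding D_def by (rule density_sequence[OF t K T _ xr]) (rule adm)
  then obtain f V where V0: "V 0 = ball x r" and seq: "\<forall>k. admissible_density t D (f k) (V k) \<and>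
     1/2 \<le> mass (f k) UNIV \<and> closure (V (Suc k)) \<subseteq> V k \<inter> T k - {q k}"
    by (elim exE conjE)
  have fV: "admissible_density t D (f k) (V k)" and f1: "1/2 \<le> mass (f k) UNIV"
    and cl: "closure (V (Suc k)) \<subseteq> V k \<inter> T k - {q k}" for k
    using seq[rule_format, of k] by simp_all
  define C where "C k = closure (V (Suc k))" for k
  have step: "C (Suc k) \<subseteq> C k" for k
    using cl[of "Suc k"] closure_subset[of "V (Suc k)"] by (auto simp: C_def)
  have anti: "C k \<subseteq> C i" if "i \<le> k" for i k using that
  proof (induction k rule: dec_induct)
    case (step k)
    then show ?case using \<open>C (Suc k) \<subseteq> C k\<close> by blast
  qed simp
  have C0: "C 0 \<subseteq> ball x r" using cl[of 0] V0 by (auto simp: C_def)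
  have "compact (C 0)"
    unfolding compact_eq_bounded_closed using bounded_subset[OF bounded_ball C0] by (simp add: C_def)
  \<comment> \<open>The given balls need only cover the intersection of the \<open>C i\<close>;
    adding the complements \<open>- C i\<close> makes an open cover of all of \<open>C 0\<close>.
    Beyond the largest index \<open>n\<close> of a finite subcover these complements no longer meet
    \<open>C n\<close>.\<close>
  moreover have "open (U i \<union> - C i)" for i
    using U[of i] unfolding C_def by (intro open_Un open_Compl closed_closure) auto
  moreover have "C 0 \<subseteq> (\<Union>i\<in>UNIV. U i \<union> - C i)"
  proof
    fix y assume y0: "y \<in> C 0"
    show "y \<in> (\<Union>i\<in>UNIV. U i \<union> - C i)"
    proof (cases "\<forall>i. y \<in> C i")
      case True
      have yT: "y \<in> T i" "y \<noteq> q i" for i using True cl[of i] by (auto simp: C_def)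
      have "y \<notin> \<rat>" using yT(2) q by (metis rangeE)
      moreover have yb: "y \<in> ball x r" using y0 C0 by blast
      moreover have "y \<noteq> 0" "y \<noteq> 1" using \<open>y \<notin> \<rat>\<close> by auto
      moreover have "y \<in> {0..1}" using yb xr(2) by blast
      ultimately have "y \<in> A \<inter> ball x r" using yT(1) A by auto
      then show ?thesis using cover by blast
    qed auto
  qed
  ultimately obtain J where J: "finite J" "C 0 \<subseteq> (\<Union>i\<in>J. U i \<union> - C i)"
    by (rule compactE_image) 
  \<comment> \<open>Inserting 0 makes the maximum meaningful for empty \<open>J\<close>.\<close>
  define n where "n = Max (insert 0 J)"
  have n: "i \<le> n" if "i \<in> J" for i using that J(1) by (simp add: n_def)
  have Cn: "C n \<subseteq> (\<Union>i\<in>J. U i)"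
  proof
    fix y assume y: "y \<in> C n"
    then have "y \<in> C 0" using anti[of 0 n] by blast
    then obtain i where i: "i \<in> J" "y \<in> U i \<union> - C i" using J(2) by blast
    moreover have "y \<in> C i" using anti[OF n[OF i(1)]] y by blast
    ultimately show "y \<in> (\<Union>i\<in>J. U i)" by blast
  qed
  \<comment> \<open>The index is shifted because \<open>C n\<close> is the closure of
    \<open>V (Suc n)\<close>, the set carrying \<open>f (Suc n)\<close>.\<close>
  define g where "g = f (Suc n)"
  obtain M where M: "bdens M g" using fV[of "Suc n"] by (auto simp: g_def admissible_density_def)
  have gV: "y \<in> C n" if "g y \<noteq> 0" for y
    using fV[of "Suc n"] that closure_subset by (auto simp: g_def admissible_density_def C_def)
  have gU: "mass g (U i) \<le> D * diameter (U i) powr t" for i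
  proof -
    obtain c \<rho> where c: "U i = ball c \<rho>" using U[of i] by blast
    show ?thesis
    proof (cases "\<rho> > 0")
      case True
      have "mass g (U i) \<le> mass g {c - \<rho>..c + \<rho>}"
        unfolding c by (rule mass_mono[OF M]) (auto simp: dist_real_def)
      also have "\<dots> \<le> D * (c + \<rho> - (c - \<rho>)) powr t"
        using fV[of "Suc n"] True by (simp only: g_def admissible_density_def)
      also have "c + \<rho> - (c - \<rho>) = diameter (U i)" using True by (simp add: c)
      finally show ?thesis .
    next
      case False
      then have "U i = {}" by (simp add: c)
      then have "mass g (U i) = 0" by (simp add: mass_def)
      then show ?thesis using D by simp
    qed
  qed
  have "1/2 \<le> mass g UNIV" using f1 by (simp add: g_def)
  also have "\<dots> \<le> (\<Sum>i\<in>J. mass g (U i))"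
  proof (rule mass_finite_cover[OF M J(1)])
    show "U i \<in> sets borel" for i using U[of i] by auto
    show "y \<in> (\<Union>i\<in>J. U i)" if "g y \<noteq> 0" for y using gV[OF that] Cn by blast
  qed
  also have "\<dots> \<le> (\<Sum>i\<in>J. D * diameter (U i) powr t)" by (rule sum_mono[OF gU])
  finally have "1/2 \<le> D * (\<Sum>i\<in>J. diameter (U i) powr t)" by (simp add: sum_distrib_left)
  then have "(2 * r) powr t * (1/2) \<le> (2 * r) powr t * (D * (\<Sum>i\<in>J. diameter (U i) powr t))"
    by (intro mult_left_mono) auto
  also have "\<dots> = 2 * ((2 * r) powr t * (2 * r) powr - t) * (\<Sum>i\<in>J. diameter (U i) powr t)"
    by (simp add: D_def)
  also have "(2 * r) powr t * (2 * r) powr - t = 1" using xr(1) by (simp flip: powr_add)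
  finally show "\<exists>J. finite J \<and> (2 * r) powr t / 4 \<le> (\<Sum>i\<in>J. diameter (U i) powr t)"
    using J(1) by (intro exI[of _ J]) simp
qed

text \<open>Collecting all levels from \<open>n0\<close> on makes the intersection over
  \<open>n0\<close> a limsup set. It is built from \<open>cyl\<close>, hence open; rational points
  are discarded separately.\<close>

definition big_window :: "nat \<Rightarrow> real \<Rightarrow> nat \<Rightarrow> real set" where
  "big_window m B n0 = \<Union> {cyl (w @ bs) | w bs. pos_word w \<and> pos_word bs \<and> length w \<ge> n0 \<and>
     length bs = m \<and> real (prod_list bs) \<ge> B ^ length w}"

lemma open_big_window: "open (big_window m B n0)"
  unfolding big_window_def by (intro open_Union ballI) (auto intro!: open_cyl)

lemma deep_big_big_window: "deep_big m B n0 (big_window m B n0)"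
  unfolding deep_big_def big_window_def by blast

lemma F_set_eq: "F_set m B = {x \<in> {0<..<1} - \<rat>. \<forall>n0. x \<in> big_window m B n0}"
proof -
  have pl: "prod_list (map (\<lambda>i. partial_quotient (Suc i) x) [n..<n + m]) = (\<Prod>i=1..m. partial_quotient (n + i) x)" for n x
  proof -
    have "prod_list (map (\<lambda>i. partial_quotient (Suc i) x) [n..<n + m]) = (\<Prod>i\<in>{n..<n + m}. partial_quotient (Suc i) x)"
      using prod.distinct_set_conv_list[of "[n..<n + m]" "\<lambda>i. partial_quotient (Suc i) x"] by simp
    also have "\<dots> = (\<Prod>i=1..m. partial_quotient (n + i) x)"
      by (rule prod.reindex_bij_witness[of _ "\<lambda>i. n + i - 1" "\<lambda>i. Suc i - n"]) auto
    finally show ?thesis .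
  qed
  have mem: "x \<in> big_window m B n0 \<longleftrightarrow> (\<exists>n\<ge>n0. real (\<Prod>i=1..m. partial_quotient (n + i) x) \<ge> B ^ n)"
    if x: "x \<in> {0<..<1} - \<rat>" for x n0
  proof
    assume "x \<in> big_window m B n0"
    then obtain w bs where w: "x \<in> cyl (w @ bs)" "pos_word w" "pos_word bs" "length w \<ge> n0"
      "length bs = m" "real (prod_list bs) \<ge> B ^ length w"
      unfolding big_window_def by blast
    have "digits (length (w @ bs)) x = w @ bs"
      by (rule cyl_disjoint[OF _ _ _ in_cyl_digits[OF x] w(1)])
         (use digits_props(1,2)[OF x] w(2,3) in auto)
    then have "digits (length w) x @ map (\<lambda>i. partial_quotient (Suc i) x) [length w..<length w + m] = w @ bs"
      using w(5) by (simp add: digits_append)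
    then have bs: "map (\<lambda>i. partial_quotient (Suc i) x) [length w..<length w + m] = bs"
      using digits_props(1)[OF x, of "length w"] by simp
    then show "\<exists>n\<ge>n0. real (\<Prod>i=1..m. partial_quotient (n + i) x) \<ge> B ^ n"
      using w(4,6) unfolding bs[symmetric] pl by blast
  next
    assume "\<exists>n\<ge>n0. real (\<Prod>i=1..m. partial_quotient (n + i) x) \<ge> B ^ n"
    then obtain n where n: "n \<ge> n0" "real (\<Prod>i=1..m. partial_quotient (n + i) x) \<ge> B ^ n" by blast
    define bs where "bs = map (\<lambda>i. partial_quotient (Suc i) x) [n..<n + m]"
    have e: "digits (n + m) x = digits n x @ bs" by (simp add: digits_append bs_def)
    have xc: "x \<in> cyl (digits n x @ bs)" using in_cyl_digits[OF x, of "n + m"] by (simp add: e)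
    have "pos_word (digits n x)" "pos_word bs"
      using digits_props(2)[OF x, of "n + m"] by (simp_all add: e)
    moreover have "length (digits n x) = n" by (rule digits_props(1)[OF x])
    moreover have "real (prod_list bs) \<ge> B ^ n" using n(2) by (simp only: bs_def pl)
    moreover have "length bs = m" by (simp add: bs_def)
    ultimately have "cyl (digits n x @ bs) \<subseteq> big_window m B n0"
      using n(1) by (intro deep_big_big_window[unfolded deep_big_def, rule_format] conjI) simp_all
    then show "x \<in> big_window m B n0" using xc by blast
  qed
  have "F_set m B = {x \<in> {0<..<1} - \<rat>. \<exists>\<^sub>\<infinity>n. real (\<Prod>i=1..m. partial_quotient (n + i) x) \<ge> B ^ n}"
  proof -
    have "{0..<1} - \<rat> = {0<..<1} - (\<rat> :: real set)" by (auto simp: less_le)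
    then show ?thesis unfolding F_set_def by simp
  qed
  also have "\<dots> = {x \<in> {0<..<1} - \<rat>. \<forall>n0. x \<in> big_window m B n0}"
    unfolding INFM_nat_le using mem by blast
  finally show ?thesis .
qed

text \<open>Besides the open windows, the countable intersection uses the complements of the single
  rationals and the interval \<open>(0, 1)\<close>.\<close>

lemma gdelta_F_set: "gdelta_in (top_of_set {0..1}) (F_set m B)"
proof -
  define X where "X = (range (big_window m B) \<union> (\<lambda>q. - {q}) ` \<rat>) \<union> {{0<..<1}}"
  have "gdelta_in euclidean (\<Inter> X)"
  proof (rule gdelta_in_Inter)
    show "countable X" unfolding X_def using countable_rat by auto
    show "gdelta_in euclidean S" if "S \<in> X" for S
      using that open_big_window unfolding X_def by (intro open_imp_gdelta_in) auto
  qed (auto simp: X_def)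
  moreover have "F_set m B = \<Inter> X \<inter> {0..1}" unfolding F_set_eq X_def by auto
  ultimately show ?thesis unfolding gdelta_in_subtopology by blast
qed

theorem theorem1p10:
  fixes m :: nat and B :: real
  assumes "m \<ge> 1" and "B > 1"
  shows "\<exists>u. 1/2 < u \<and> u < 1 \<and>
           has_pressure (\<lambda>x. - u * ln \<bar>deriv gauss_map x\<bar> - g_exponent m u * ln B) 0 \<and>
           F_set m B \<in> large_intersection_class u"
proof -
  obtain u where u: "1/2 < u" "u < 1" "pr u = gbal m u * ln B"
    and below: "\<And>t. 1/2 < t \<Longrightarrow> t < u \<Longrightarrow> pr t > gbal m t * ln B"
    using pressure_zero[OF assms(2,1)] by blast
  have "has_pressure (\<lambda>x. - u * ln \<bar>deriv gauss_map x\<bar> - g_exponent m u * ln B) 0"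
    using has_pressure_pr[of u "g_exponent m u * ln B"] u g_exponent_eq_gbal[OF u(1,2) assms(1)]
    by (simp add: zero_ereal_def)
  moreover have "F_set m B \<in> large_intersection_class u"
  proof -
    have content: "hausdorff_content t (F_set m B \<inter> ball x r) > ennreal (1/8) * hausdorff_content t (ball x r)"
      if t: "0 < t" "t < u" and xr: "0 < r" "ball x r \<subseteq> {0..1}" for t x r
    proof -
      \<comment> \<open>Blocks require an exponent strictly between 1/2 and \<open>u\<close>, while
        \<open>t\<close> may be as small as one likes; the densities are built at \<open>s\<close>
        and their exponent is then lowered to \<open>t\<close>.\<close>
      define s where "s = (max t (1/2) + u) / 2"
      have s: "1/2 < s" "s < u" "t \<le> s" using t u by (auto simp: s_def)
      obtain n W where W: "finite W" "W \<subseteq> words n" "sum (wt s) W > 32 * exp (gbal m s * ln B * real n)"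
        using finite_block_exists[of s, OF _ _ below[OF s(1,2)]] s u by auto
      have s1: "s < 1" using s u by simp
      have W0: "W \<noteq> {}" using W(3) by (auto simp: not_less)
      have Wp: "pos_word w" "length w = n" if "w \<in> W" for w using W(2) that by (auto simp: words_iff)
      have "32 * B powr (gbal m s * real n) \<le> (\<Sum>w\<in>W. den w 0 powr (- 2 * s))"
        using W(3) assms(2) by (simp add: wt_def powr_def mult_ac)
      then have "\<exists>K\<ge>1. \<forall>T n0 u. deep_big m B n0 T \<and> pos_word u \<and> length u \<ge> n0 \<longrightarrow> adm T s K u"
        unfolding gbal_def by (intro adm_deep[OF s(1) s1 assms W(1) W0 Wp])
      then obtain K where K: "K \<ge> 1"
        "\<forall>T n0 u. deep_big m B n0 T \<and> pos_word u \<and> length u \<ge> n0 \<longrightarrow> adm T s K u"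
        by auto
      have adm: "adm (big_window m B n) t K v" if "pos_word v" "length v \<ge> n" for v n
        using K deep_big_big_window that by (intro adm_exponent[OF _ t(1) s(3)]) blast+
      have "ennreal (1/8) * hausdorff_content t (ball x r) \<le> ennreal (1/8) * ennreal ((2 * r) powr t)"
        by (intro mult_left_mono hausdorff_content_ball_le t xr) simp
      also have "\<dots> = ennreal ((2 * r) powr t / 8)" by (simp add: ennreal_mult[symmetric])
      \<comment> \<open>Halving the 1/4 from \<open>content_limsup_set\<close> gives the strict
        inequality that the class demands.\<close>
      also have "\<dots> < ennreal ((2 * r) powr t / 4)" using xr(1) by (intro ennreal_lessI) auto
      also have "\<dots> \<le> hausdorff_content t (F_set m B \<inter> ball x r)"
        by (rule content_limsup_set[OF t(1) _ K(1) open_big_window adm _ xr]) (use t u in \<open>auto simp: F_set_eq\<close>)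
      finally show ?thesis .
    qed
    have "\<exists>c>0. \<forall>t. 0 < t \<and> t < u \<longrightarrow> (\<forall>x r. 0 < r \<and> ball x r \<subseteq> {0..1} \<longrightarrow>
        hausdorff_content t (F_set m B \<inter> ball x r) > ennreal c * hausdorff_content t (ball x r))"
      using content by (intro exI[of _ "1/8"]) simp
    then show ?thesis unfolding large_intersection_class_def using gdelta_F_set by blast
  qed
  ultimately show ?thesis using u by blast
qed

end
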